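(* For $n\ge4$ there is no epimorphism (surjective group homomorphism) from the McCool group $P\Sigma_n$ to the upper McCool group $P\Sigma_n^+$.
   Context: Let $F_n=\langle x_1,\dots,x_n\rangle$ be the free group; for $1\le i\neq j\le n$ let $\alpha_{ij}\in\mathrm{Aut}(F_n)$ send $x_i\mapsto x_jx_ix_j^{-1}$ and fix the other generators. The McCool group $P\Sigma_n$ is the group of automorphisms of $F_n$ sending each $x_i$ to a conjugate of itself; it is generated by all the $\alpha_{ij}$, $i\ne j$. The upper McCool group $P\Sigma_n^+$ is the subgroup generated by the $\alpha_{ij}$ with $i>j$. *)

theory Defs
  imports "HOL-Algebra.Bij" "HOL-Algebra.Generated_Groups"
begin

section \<open>Free groups as groups of reduced words\<close>

text \<open>
  The letter \<open>(x, True)\<close> stands for the generator \<open>x\<close> and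
  \<open>(x, False)\<close> for its inverse.
\<close>

type_synonym 'a word = "('a \<times> bool) list"

definition letter_inv :: "'a \<times> bool \<Rightarrow> 'a \<times> bool" where
  "letter_inv p = (fst p, \<not> snd p)"

definition reduced :: "'a word \<Rightarrow> bool" where
  "reduced = successively (\<lambda>p q. q \<noteq> letter_inv p)"

fun cancel_cons :: "'a \<times> bool \<Rightarrow> 'a word \<Rightarrow> 'a word" where
  "cancel_cons p [] = [p]"
| "cancel_cons p (q # w) = (if q = letter_inv p then w else p # q # w)"

definition word_mult :: "'a word \<Rightarrow> 'a word \<Rightarrow> 'a word" where
  "word_mult u v = foldr cancel_cons u v"

definition free_group :: "'a set \<Rightarrow> 'a word monoid" where
  "free_group X = \<lparr>carrier = {w. set w \<subseteq> X \<times> UNIV \<and> reduced w}, mult = word_mult, one = []\<rparr>"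

lemma letter_inv_invol [simp]: "letter_inv (letter_inv p) = p"
  by (simp add: letter_inv_def)

lemma letter_inv_ne [simp]: "letter_inv p \<noteq> p" "p \<noteq> letter_inv p"
  by (cases p; simp add: letter_inv_def)+

lemma reduced_Nil [simp]: "reduced []"
  by (simp add: reduced_def)

lemma reduced_Cons: "reduced (p # w) \<longleftrightarrow> (w = [] \<or> hd w \<noteq> letter_inv p) \<and> reduced w"
  by (auto simp: reduced_def successively_Cons)

lemma reduced_cancel_cons: "reduced w \<Longrightarrow> reduced (cancel_cons p w)"
  by (cases w) (auto simp: reduced_Cons)

lemma set_cancel_cons: "set (cancel_cons p w) \<subseteq> insert p (set w)"
  by (cases w) auto

lemma cancel_cons_reduced: "reduced (p # w) \<Longrightarrow> cancel_cons p w = p # w"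
  by (cases w) (auto simp: reduced_Cons)

lemma cancel_cons_cancel: "reduced w \<Longrightarrow> cancel_cons p (cancel_cons (letter_inv p) w) = w"
  by (cases w) (auto simp: reduced_Cons cancel_cons_reduced)

lemma reduced_word_mult: "reduced v \<Longrightarrow> reduced (word_mult u v)"
  unfolding word_mult_def by (induction u) (auto simp: reduced_cancel_cons)

lemma set_word_mult: "set (word_mult u v) \<subseteq> set u \<union> set v"
  unfolding word_mult_def by (induction u) (use set_cancel_cons in fastforce)+

lemma word_mult_Nil [simp]: "word_mult [] v = v"
  by (simp add: word_mult_def)

lemma word_mult_Cons: "word_mult (p # u) v = cancel_cons p (word_mult u v)"
  by (simp add: word_mult_def)

lemma word_mult_append: "word_mult (u @ v) w = word_mult u (word_mult v w)"
  by (simp add: word_mult_def)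

lemma word_mult_cancel_cons:
  assumes "reduced w"
  shows "word_mult (cancel_cons p u) w = cancel_cons p (word_mult u w)"
proof (cases u)
  case (Cons q u')
  then show ?thesis
    using assms by (auto simp: word_mult_Cons cancel_cons_cancel reduced_word_mult)
qed (simp add: word_mult_Cons)

lemma word_mult_assoc:
  "reduced w \<Longrightarrow> word_mult (word_mult u v) w = word_mult u (word_mult v w)"
  by (induction u) (simp_all add: word_mult_Cons word_mult_cancel_cons)

lemma word_mult_Nil2: "reduced u \<Longrightarrow> word_mult u [] = u"
  by (induction u) (auto simp: word_mult_Cons reduced_Cons cancel_cons_reduced)

lemma word_mult_rev_inv: "reduced w \<Longrightarrow> word_mult (rev (map letter_inv u)) (word_mult u w) = w"
proof (induction u arbitrary: w)
  case (Cons p u)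
  then show ?case
    using cancel_cons_cancel[of "word_mult u w" "letter_inv p"]
    by (simp add: word_mult_append word_mult_Cons reduced_word_mult)
qed simp

lemma reduced_rev_inv: "reduced u \<Longrightarrow> reduced (rev (map letter_inv u))"
  unfolding reduced_def successively_rev successively_map
  by (erule successively_mono) (metis letter_inv_invol)

lemma group_free_group: "group (free_group X)"
proof (rule groupI)
  fix u assume u: "u \<in> carrier (free_group X)"
  show "\<exists>v\<in>carrier (free_group X). v \<otimes>\<^bsub>free_group X\<^esub> u = \<one>\<^bsub>free_group X\<^esub>"
  proof (rule bexI)
    show "rev (map letter_inv u) \<otimes>\<^bsub>free_group X\<^esub> u = \<one>\<^bsub>free_group X\<^esub>"
      using u word_mult_rev_inv[of "[]" u] by (simp add: free_group_def word_mult_Nil2)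
    show "rev (map letter_inv u) \<in> carrier (free_group X)"
      using u by (auto simp: free_group_def reduced_rev_inv letter_inv_def)
  qed
next
  fix u v assume "u \<in> carrier (free_group X)" "v \<in> carrier (free_group X)"
  then show "u \<otimes>\<^bsub>free_group X\<^esub> v \<in> carrier (free_group X)"
    using set_word_mult[of u v] by (auto simp: free_group_def reduced_word_mult)
qed (auto simp: free_group_def word_mult_assoc)

definition free_gen :: "'a \<Rightarrow> 'a word" where
  "free_gen x = [(x, True)]"

text \<open>The extension of a map on generators to a homomorphism into \<open>G\<close>.\<close>

definition free_lift :: "('b, 'c) monoid_scheme \<Rightarrow> ('a \<Rightarrow> 'b) \<Rightarrow> 'a word \<Rightarrow> 'b" where
  "free_lift G f w =
     foldr (\<lambda>(x, s) g. (if s then f x else inv\<^bsub>G\<^esub> (f x)) \<otimes>\<^bsub>G\<^esub> g) w \<one>\<^bsub>G\<^esub>"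

lemma free_gen_closed: "x \<in> X \<Longrightarrow> free_gen x \<in> carrier (free_group X)"
  by (simp add: free_gen_def free_group_def reduced_Cons)

context group
begin

lemma free_lift_closed:
  assumes "f \<in> X \<rightarrow> carrier G" "set w \<subseteq> X \<times> UNIV"
  shows "free_lift G f w \<in> carrier G"
  using assms(2) unfolding free_lift_def
  by (induction w) (use assms(1) in \<open>auto simp: Pi_iff\<close>)

lemma free_lift_cancel_cons:
  assumes f: "f \<in> X \<rightarrow> carrier G" and w: "set w \<subseteq> X \<times> UNIV" and p: "p \<in> X \<times> UNIV"
  shows "free_lift G f (cancel_cons p w) = free_lift G f (p # w)"
proof (cases w)
  case (Cons q w')
  have "free_lift G f w' \<in> carrier G" "f (fst p) \<in> carrier G"
    using f w p by (auto intro!: free_lift_closed[OF f] simp: Cons)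
  then show ?thesis
    using p Cons
    by (cases p; cases q) (auto simp: free_lift_def letter_inv_def m_assoc [symmetric])
qed simp

lemma free_lift_hom:
  assumes f: "f \<in> X \<rightarrow> carrier G"
  shows "free_lift G f \<in> hom (free_group X) G"
proof (rule homI)
  fix w assume "w \<in> carrier (free_group X)"
  then show "free_lift G f w \<in> carrier G"
    using free_lift_closed[OF f] by (simp add: free_group_def)
next
  fix u v assume "u \<in> carrier (free_group X)" "v \<in> carrier (free_group X)"
  then have u: "set u \<subseteq> X \<times> UNIV" and v: "set v \<subseteq> X \<times> UNIV"
    by (auto simp: free_group_def)
  have "free_lift G f (word_mult u v) = free_lift G f u \<otimes> free_lift G f v"
    using u
  proof (induction u)
    case Nil
    then show ?case
      using free_lift_closed[OF f v] by (simp add: free_lift_def[of _ _ "[]"])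
  next
    case (Cons p u)
    have *: "set (word_mult u v) \<subseteq> X \<times> UNIV" "p \<in> X \<times> UNIV"
      using Cons.prems v set_word_mult[of u v] by auto
    have cl: "free_lift G f u \<in> carrier G" "free_lift G f v \<in> carrier G" "f (fst p) \<in> carrier G"
      using Cons.prems f v by (auto intro!: free_lift_closed[OF f])
    have "free_lift G f (word_mult (p # u) v) = free_lift G f (p # word_mult u v)"
      unfolding word_mult_Cons by (rule free_lift_cancel_cons[OF f *])
    also have "\<dots> = free_lift G f (p # u) \<otimes> free_lift G f v"
      using Cons.IH Cons.prems cl
      by (cases p) (auto simp: free_lift_def[of _ _ "_ # _"] m_assoc simp flip: free_lift_def)
    finally show ?case .
  qed
  then show "free_lift G f (u \<otimes>\<^bsub>free_group X\<^esub> v) = free_lift G f u \<otimes> free_lift G f v"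
    by (simp add: free_group_def)
qed

lemma free_lift_gen:
  assumes "f x \<in> carrier G"
  shows "free_lift G f (free_gen x) = f x"
  using assms by (simp add: free_lift_def free_gen_def)

lemma free_lift_unique:
  assumes h: "h \<in> hom (free_group X) G" and w: "w \<in> carrier (free_group X)"
  shows "h w = free_lift G (h \<circ> free_gen) w"
  using w
proof (induction w)
  case Nil
  show ?case
    using hom_one[OF h group_free_group is_group] by (simp add: free_group_def free_lift_def)
next
  case (Cons p w)
  obtain x s where p: "p = (x, s)" by fastforce
  interpret F: group "free_group X" by (rule group_free_group)
  have w: "w \<in> carrier (free_group X)" and x: "x \<in> X"
    using Cons.prems p by (auto simp: free_group_def reduced_Cons)
  have lc: "[(x, b)] \<in> carrier (free_group X)" for b
    using x by (simp add: free_group_def reduced_Cons)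
  have "[(x, False)] = inv\<^bsub>free_group X\<^esub> free_gen x"
    by (rule F.inv_equality [symmetric])
       (use lc free_gen_closed[OF x] in \<open>auto simp: free_group_def free_gen_def word_mult_def letter_inv_def\<close>)
  then have "h [(x, s)] = (if s then h (free_gen x) else inv (h (free_gen x)))"
    using group_hom.hom_inv[of "free_group X" G h "free_gen x"] h free_gen_closed[OF x]
    by (auto simp: free_gen_def group_hom_def group_hom_axioms_def group_free_group is_group)
  moreover have "p # w = [(x, s)] \<otimes>\<^bsub>free_group X\<^esub> w"
    using Cons.prems p by (simp add: free_group_def word_mult_def cancel_cons_reduced)
  then have "h (p # w) = h [(x, s)] \<otimes> h w"
    using hom_mult[OF h lc w] by simp
  ultimately show ?case
    using Cons.IH[OF w] by (simp add: p free_lift_def)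
qed

end

lemma free_group_hom_eqI:
  assumes "group G" "g \<in> hom (free_group X) G" "h \<in> hom (free_group X) G"
    and eq: "\<And>x. x \<in> X \<Longrightarrow> g (free_gen x) = h (free_gen x)"
    and w: "w \<in> carrier (free_group X)"
  shows "g w = h w"
proof -
  have "free_lift G (g \<circ> free_gen) w = free_lift G (h \<circ> free_gen) w"
    unfolding free_lift_def
    by (rule foldr_cong) (use w eq in \<open>auto simp: free_group_def\<close>)
  then show ?thesis
    using group.free_lift_unique[OF assms(1) _ w] assms(2,3) by simp
qed


section \<open>McCool groups\<close>

definition Free :: "nat \<Rightarrow> nat word monoid" where
  "Free n = free_group {1..n}"

lemma group_Free: "group (Free n)"
  by (simp add: Free_def group_free_group)

lemma Free_gen_closed: "i \<in> {1..n} \<Longrightarrow> free_gen i \<in> carrier (Free n)"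
  unfolding Free_def by (rule free_gen_closed)

definition conj_map :: "nat \<Rightarrow> nat \<Rightarrow> nat word \<Rightarrow> nat word \<Rightarrow> nat word" where
  "conj_map n i c =
     restrict
       (free_lift (Free n)
         (\<lambda>k. if k = i then c \<otimes>\<^bsub>Free n\<^esub> free_gen i \<otimes>\<^bsub>Free n\<^esub> inv\<^bsub>Free n\<^esub> c
              else free_gen k))
       (carrier (Free n))"

definition mccool_alpha :: "nat \<Rightarrow> nat \<Rightarrow> nat \<Rightarrow> nat word \<Rightarrow> nat word" where
  "mccool_alpha n i j = conj_map n i (free_gen j)"

text \<open>
  The group operation of \<^const>\<open>AutoGroup\<close> is composition of maps; its elements are
  extensional functions, that is, \<^const>\<open>undefined\<close> off the carrier.
\<close>

definition McCool_group :: "nat \<Rightarrow> (nat word \<Rightarrow> nat word) monoid" where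
  "McCool_group n = (AutoGroup (Free n))
     \<lparr>carrier := {\<phi> \<in> carrier (AutoGroup (Free n)).
        \<forall>i\<in>{1..n}. \<exists>w\<in>carrier (Free n).
          \<phi> (free_gen i) = w \<otimes>\<^bsub>Free n\<^esub> free_gen i \<otimes>\<^bsub>Free n\<^esub> inv\<^bsub>Free n\<^esub> w}\<rparr>"

definition upper_McCool_group :: "nat \<Rightarrow> (nat word \<Rightarrow> nat word) monoid" where
  "upper_McCool_group n = (AutoGroup (Free n))
     \<lparr>carrier := generate (AutoGroup (Free n)) {mccool_alpha n i j | i j. 1 \<le> j \<and> j < i \<and> i \<le> n}\<rparr>"

lemma conj_map_gen:
  assumes "c \<in> carrier (Free n)" "k \<in> {1..n}"
  shows "conj_map n i c (free_gen k) =
    (if k = i then c \<otimes>\<^bsub>Free n\<^esub> free_gen i \<otimes>\<^bsub>Free n\<^esub> inv\<^bsub>Free n\<^esub> c else free_gen k)"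
proof -
  interpret group "Free n" by (rule group_Free)
  show ?thesis
    using assms Free_gen_closed[of k n]
    by (auto simp: conj_map_def free_lift_gen)
qed

lemma conj_map_hom:
  assumes "c \<in> carrier (Free n)"
  shows "conj_map n i c \<in> hom (Free n) (Free n)"
proof -
  interpret group "Free n" by (rule group_Free)
  have "free_gen k \<in> carrier (Free n)" if "k \<in> {1..n}" for k
    using that by (rule Free_gen_closed)
  then have "free_lift (Free n) (\<lambda>k. if k = i
      then c \<otimes>\<^bsub>Free n\<^esub> free_gen i \<otimes>\<^bsub>Free n\<^esub> inv\<^bsub>Free n\<^esub> c
      else free_gen k) \<in> hom (free_group {1..n}) (Free n)"
    by (intro free_lift_hom) (use assms in auto)
  then have "free_lift (Free n) (\<lambda>k. if k = i
      then c \<otimes>\<^bsub>Free n\<^esub> free_gen i \<otimes>\<^bsub>Free n\<^esub> inv\<^bsub>Free n\<^esub> c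
      else free_gen k) \<in> hom (Free n) (Free n)"
    by (simp add: Free_def)
  then show ?thesis
    unfolding conj_map_def hom_def by (auto simp: Pi_iff)
qed

lemma conj_map_inverse:
  assumes ij: "i \<in> {1..n}" "j \<in> {1..n}" "i \<noteq> j"
    and c: "c \<in> {free_gen j, inv\<^bsub>Free n\<^esub> free_gen j}"
    and w: "w \<in> carrier (Free n)"
  shows "conj_map n i (inv\<^bsub>Free n\<^esub> c) (conj_map n i c w) = w"
proof -
  interpret group "Free n" by (rule group_Free)
  have g: "free_gen k \<in> carrier (Free n)" if "k \<in> {1..n}" for k
    using that by (rule Free_gen_closed)
  have cc: "c \<in> carrier (Free n)"
    using c g[OF ij(2)] by auto
  let ?g = "conj_map n i (inv\<^bsub>Free n\<^esub> c)" and ?h = "conj_map n i c"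
  have hg: "?g \<in> hom (Free n) (Free n)" and hh: "?h \<in> hom (Free n) (Free n)"
    using conj_map_hom cc by auto
  interpret g: group_hom "Free n" "Free n" ?g
    by unfold_locales (rule hg)
  have gj: "?g (free_gen j) = free_gen j"
    using conj_map_gen[of "inv\<^bsub>Free n\<^esub> c" n j i] cc ij by simp
  have "?g (inv\<^bsub>Free n\<^esub> free_gen j) = inv\<^bsub>Free n\<^esub> free_gen j"
    using g.hom_inv[OF g[OF ij(2)]] by (simp only: gj)
  then have gc: "?g c = c"
    using c gj by (metis insertE singletonD)
  have "(?g \<circ> ?h) w = id w"
  proof (rule free_group_hom_eqI[OF group_Free _ _ _ w[unfolded Free_def]])
    show "?g \<circ> ?h \<in> hom (free_group {1..n}) (Free n)"
      using Group.hom_compose[OF hh hg] by (simp add: Free_def)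
    show "id \<in> hom (free_group {1..n}) (Free n)"
      by (simp add: hom_def Free_def)
    fix k assume k: "k \<in> {1..n}"
    have "?g (c \<otimes>\<^bsub>Free n\<^esub> free_gen i \<otimes>\<^bsub>Free n\<^esub> inv\<^bsub>Free n\<^esub> c) = free_gen i"
      using cc g[OF ij(1)] ij(1)
      by (simp add: g.hom_inv gc conj_map_gen m_assoc) (simp add: m_assoc [symmetric])
    then show "(?g \<circ> ?h) (free_gen k) = id (free_gen k)"
      using k cc by (simp add: conj_map_gen)
  qed
  then show ?thesis by simp
qed

lemma mccool_alpha_auto:
  assumes ij: "i \<in> {1..n}" "j \<in> {1..n}" "i \<noteq> j"
  shows "mccool_alpha n i j \<in> carrier (AutoGroup (Free n))"
proof -
  interpret group "Free n" by (rule group_Free)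
  have g: "free_gen j \<in> carrier (Free n)"
    using ij(2) by (rule Free_gen_closed)
  let ?h = "conj_map n i (free_gen j)" and ?h' = "conj_map n i (inv\<^bsub>Free n\<^esub> free_gen j)"
  have "?h \<in> hom (Free n) (Free n)" "?h' \<in> hom (Free n) (Free n)"
    using g by (auto intro!: conj_map_hom)
  moreover have "?h' (?h w) = w" "?h (?h' w) = w" if "w \<in> carrier (Free n)" for w
    using conj_map_inverse[OF ij, of "free_gen j" w]
      conj_map_inverse[OF ij, of "inv\<^bsub>Free n\<^esub> free_gen j" w] that g by auto
  ultimately have "bij_betw ?h (carrier (Free n)) (carrier (Free n))"
    by (intro bij_betw_byWitness[where f' = ?h']) (auto simp: hom_def)
  with \<open>?h \<in> hom (Free n) (Free n)\<close> show ?thesis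
    by (auto simp: mccool_alpha_def AutoGroup_def auto_def Bij_def) (simp add: conj_map_def)
qed

lemma group_upper_McCool_group: "group (upper_McCool_group n)"
proof -
  interpret A: group "AutoGroup (Free n)"
    by (intro group.AutoGroup group_Free)
  show ?thesis
    unfolding upper_McCool_group_def
    by (intro A.subgroup_imp_group A.generate_is_subgroup) (auto intro!: mccool_alpha_auto)
qed

lemma group_McCool_group: "group (McCool_group n)"
proof -
  interpret group "Free n" by (rule group_Free)
  interpret A: group "AutoGroup (Free n)"
    by (intro group.AutoGroup group_Free)
  have mult: "(\<phi> \<otimes>\<^bsub>AutoGroup (Free n)\<^esub> \<psi>) w = \<phi> (\<psi> w)"
    if "\<phi> \<in> carrier (AutoGroup (Free n))" "\<psi> \<in> carrier (AutoGroup (Free n))" "w \<in> carrier (Free n)"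
    for \<phi> \<psi> w
    using that by (simp add: AutoGroup_def auto_def BijGroup_def compose_def)
  have one: "\<one>\<^bsub>AutoGroup (Free n)\<^esub> w = w" if "w \<in> carrier (Free n)" for w
    using that by (simp add: AutoGroup_def BijGroup_def)
  have hom: "group_hom (Free n) (Free n) \<phi>" if "\<phi> \<in> carrier (AutoGroup (Free n))" for \<phi>
    using that by unfold_locales (simp add: AutoGroup_def auto_def)
  have gen: "free_gen i \<in> carrier (Free n)" if "i \<in> {1..n}" for i
    using that by (rule Free_gen_closed)
  let ?S = "carrier (McCool_group n)"
  have S: "\<phi> \<in> ?S \<longleftrightarrow> \<phi> \<in> carrier (AutoGroup (Free n)) \<and> (\<forall>i\<in>{1..n}. \<exists>w\<in>carrier (Free n).
      \<phi> (free_gen i) = w \<otimes>\<^bsub>Free n\<^esub> free_gen i \<otimes>\<^bsub>Free n\<^esub> inv\<^bsub>Free n\<^esub> w)" for \<phi>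
    by (simp add: McCool_group_def)
  have "subgroup ?S (AutoGroup (Free n))"
  proof (rule A.subgroupI)
    show "?S \<subseteq> carrier (AutoGroup (Free n))"
      using S by blast
    have "\<one>\<^bsub>AutoGroup (Free n)\<^esub> \<in> ?S"
      unfolding S by (auto intro!: bexI[of _ "\<one>\<^bsub>Free n\<^esub>"] simp: one gen)
    then show "?S \<noteq> {}" by blast
  next
    fix \<phi> assume \<phi>: "\<phi> \<in> ?S"
    then have a: "\<phi> \<in> carrier (AutoGroup (Free n))" by (simp add: S)
    let ?\<psi> = "inv\<^bsub>AutoGroup (Free n)\<^esub> \<phi>"
    have b: "?\<psi> \<in> carrier (AutoGroup (Free n))" using a by simp
    interpret \<psi>: group_hom "Free n" "Free n" ?\<psi> by (rule hom[OF b])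
    have "\<exists>w\<in>carrier (Free n). ?\<psi> (free_gen i) = w \<otimes>\<^bsub>Free n\<^esub> free_gen i \<otimes>\<^bsub>Free n\<^esub> inv\<^bsub>Free n\<^esub> w"
      if i: "i \<in> {1..n}" for i
    proof -
      obtain w where w: "w \<in> carrier (Free n)"
        and eq: "\<phi> (free_gen i) = w \<otimes>\<^bsub>Free n\<^esub> free_gen i \<otimes>\<^bsub>Free n\<^esub> inv\<^bsub>Free n\<^esub> w"
        using \<phi> i unfolding S by blast
      have "free_gen i = ?\<psi> (\<phi> (free_gen i))"
        using mult[OF b a gen[OF i]] a one[OF gen[OF i]] by simp
      also have "\<dots> = ?\<psi> w \<otimes>\<^bsub>Free n\<^esub> ?\<psi> (free_gen i) \<otimes>\<^bsub>Free n\<^esub> inv\<^bsub>Free n\<^esub> ?\<psi> w"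
        using w gen[OF i] by (simp add: eq)
      finally have e: "free_gen i = ?\<psi> w \<otimes>\<^bsub>Free n\<^esub> ?\<psi> (free_gen i) \<otimes>\<^bsub>Free n\<^esub> inv\<^bsub>Free n\<^esub> ?\<psi> w" .
      have "?\<psi> (free_gen i) = inv\<^bsub>Free n\<^esub> ?\<psi> w \<otimes>\<^bsub>Free n\<^esub>
          (?\<psi> w \<otimes>\<^bsub>Free n\<^esub> ?\<psi> (free_gen i) \<otimes>\<^bsub>Free n\<^esub> inv\<^bsub>Free n\<^esub> ?\<psi> w) \<otimes>\<^bsub>Free n\<^esub> ?\<psi> w"
        using w gen[OF i] by (simp add: m_assoc) (simp add: m_assoc [symmetric])
      then have "?\<psi> (free_gen i) = inv\<^bsub>Free n\<^esub> ?\<psi> w \<otimes>\<^bsub>Free n\<^esub> free_gen i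
          \<otimes>\<^bsub>Free n\<^esub> inv\<^bsub>Free n\<^esub> (inv\<^bsub>Free n\<^esub> ?\<psi> w)"
        using e w by simp
      then show ?thesis
        using w by (intro bexI[of _ "inv\<^bsub>Free n\<^esub> ?\<psi> w"]) auto
    qed
    then show "?\<psi> \<in> ?S" using b by (simp add: S)
  next
    fix \<phi> \<psi> assume \<phi>: "\<phi> \<in> ?S" and \<psi>: "\<psi> \<in> ?S"
    then have a: "\<phi> \<in> carrier (AutoGroup (Free n))" and b: "\<psi> \<in> carrier (AutoGroup (Free n))"
      by (auto simp: S)
    interpret \<phi>: group_hom "Free n" "Free n" \<phi> by (rule hom[OF a])
    have "\<exists>w\<in>carrier (Free n). (\<phi> \<otimes>\<^bsub>AutoGroup (Free n)\<^esub> \<psi>) (free_gen i) =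
        w \<otimes>\<^bsub>Free n\<^esub> free_gen i \<otimes>\<^bsub>Free n\<^esub> inv\<^bsub>Free n\<^esub> w" if i: "i \<in> {1..n}" for i
    proof -
      obtain v w where v: "v \<in> carrier (Free n)" "\<phi> (free_gen i) = v \<otimes>\<^bsub>Free n\<^esub> free_gen i \<otimes>\<^bsub>Free n\<^esub> inv\<^bsub>Free n\<^esub> v"
        and w: "w \<in> carrier (Free n)" "\<psi> (free_gen i) = w \<otimes>\<^bsub>Free n\<^esub> free_gen i \<otimes>\<^bsub>Free n\<^esub> inv\<^bsub>Free n\<^esub> w"
        using \<phi> \<psi> i unfolding S by blast
      show ?thesis
        using v w gen[OF i]
        by (intro bexI[of _ "\<phi> w \<otimes>\<^bsub>Free n\<^esub> v"])
           (simp_all add: mult[OF a b] m_assoc inv_mult_group)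
    qed
    then show "\<phi> \<otimes>\<^bsub>AutoGroup (Free n)\<^esub> \<psi> \<in> ?S"
      using a b by (simp add: S)
  qed
  then have "group (AutoGroup (Free n) \<lparr>carrier := ?S\<rparr>)"
    by (rule A.subgroup_imp_group)
  then show ?thesis
    by (simp add: McCool_group_def)
qed

lemma mccool_alpha_in_McCool_group:
  assumes ij: "i \<in> {1..n}" "j \<in> {1..n}" "i \<noteq> j"
  shows "mccool_alpha n i j \<in> carrier (McCool_group n)"
proof -
  interpret group "Free n" by (rule group_Free)
  have g: "free_gen k \<in> carrier (Free n)" if "k \<in> {1..n}" for k
    using that by (rule Free_gen_closed)
  have "\<exists>w\<in>carrier (Free n). mccool_alpha n i j (free_gen k) =
      w \<otimes>\<^bsub>Free n\<^esub> free_gen k \<otimes>\<^bsub>Free n\<^esub> inv\<^bsub>Free n\<^esub> w" if "k \<in> {1..n}" for k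
    using that g[OF that] g[OF ij(2)]
    by (intro bexI[of _ "if k = i then free_gen j else \<one>\<^bsub>Free n\<^esub>"])
       (auto simp: mccool_alpha_def conj_map_gen)
  then show ?thesis
    using mccool_alpha_auto[OF ij] by (simp add: McCool_group_def)
qed

end

theory Submission
  imports Defs "HOL-Algebra.Elementary_Groups"
begin

text \<open>
  Let \<open>u\<^sub>i\<^sub>j\<close> be the coordinate of \<open>H\<^sup>1\<close> dual to \<open>\<alpha>\<^sub>i\<^sub>j\<close>. In the upper McCool group the cup products
  \<open>u\<^sub>i\<^sub>j (u\<^sub>i\<^sub>k - u\<^sub>j\<^sub>k)\<close> with \<open>k < j < i\<close> vanish: second-order Magnus coefficients of the
  conjugators provide homomorphisms to Heisenberg groups. An epimorphism pulls the five independent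
  classes \<open>u\<^sub>4\<^sub>3\<close>, \<open>u\<^sub>4\<^sub>2\<close>, \<open>u\<^sub>3\<^sub>2\<close>, \<open>u\<^sub>4\<^sub>1 - u\<^sub>2\<^sub>1\<close>, \<open>u\<^sub>3\<^sub>1 - u\<^sub>2\<^sub>1\<close> back to independent classes of the
  full McCool group with the same vanishing products. By Cohen's description of the resonance
  variety of the McCool group, two independent classes with zero cup product lie in a
  common component \<open>C\<^sub>i\<^sub>j\<close> or \<open>C\<^sub>i\<^sub>j\<^sub>k\<close>, and distinct components meet trivially; the relative position
  of the five classes is incompatible with this. Independence of the pullbacks uses that the
  \<open>\<alpha>\<^sub>i\<^sub>j\<close> generate the McCool group, which is proved by Nielsen's method.
\<close>

section \<open>Magnus coefficients\<close>

text \<open>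
  For distinct \<open>js = [j\<^sub>1, \<dots>, j\<^sub>m]\<close> this is the coefficient of \<open>X\<^sub>j\<^sub>1 \<cdots> X\<^sub>j\<^sub>m\<close> in the Magnus expansion
  \<open>x \<mapsto> 1 + X\<close>; with repetitions the higher terms of \<open>x\<inverse> \<mapsto> 1 - X + X\<^sup>2 - \<dots>\<close> are missing.
\<close>

fun magnus :: "'a list \<Rightarrow> 'a word \<Rightarrow> int" where
  "magnus [] w = 1"
| "magnus (j # js) [] = 0"
| "magnus (j # js) ((x, s) # w) =
     magnus (j # js) w + (if x = j then (if s then 1 else -1) * magnus js w else 0)"

lemma magnus_Nil [simp]: "magnus js [] = (if js = [] then 1 else 0)"
  by (cases js) auto

lemma magnus_Cons_notin: "x \<notin> set js \<Longrightarrow> magnus js ((x, s) # w) = magnus js w"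
  by (cases js) auto

text \<open>The linear contributions of a cancelling pair are opposite, and since \<open>js\<close>
  is distinct the generator cannot be used a second time, so no quadratic term arises.\<close>

lemma magnus_cancel_cons:
  assumes "distinct js"
  shows "magnus js (cancel_cons p w) = magnus js (p # w)"
proof (cases w)
  case (Cons q w')
  show ?thesis
  proof (cases "q = letter_inv p")
    case True
    with assms show ?thesis
      by (cases js; cases p) (auto simp: Cons letter_inv_def magnus_Cons_notin)
  qed (simp add: Cons)
qed simp

lemma magnus_word_mult: "distinct js \<Longrightarrow> magnus js (word_mult u v) = magnus js (u @ v)"
proof (induction u arbitrary: js)
  case (Cons p u)
  then show ?case
    by (cases js; cases p) (auto simp: word_mult_Cons magnus_cancel_cons)
qed simp

text \<open>Concatenation multiplies the factors \<open>1 + X\<close> and \<open>1 - X\<close> of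
  the letters, so a coefficient sums over all ways to cut the monomial in two, here and in degrees
  two and three.\<close>

lemma magnus1_append: "magnus [j] (u @ v) = magnus [j] u + magnus [j] v"
  by (induction u) (auto)

lemma magnus2_append:
  "magnus [j, k] (u @ v) = magnus [j, k] u + magnus [j] u * magnus [k] v + magnus [j, k] v"
  by (induction u) (auto simp: magnus1_append algebra_simps)

lemma magnus3_append:
  "magnus [j, k, l] (u @ v) =
     magnus [j, k, l] u + magnus [j, k] u * magnus [l] v + magnus [j] u * magnus [k, l] v + magnus [j, k, l] v"
  by (induction u) (auto simp: magnus2_append magnus1_append algebra_simps)

lemma Free_mult [simp]: "u \<otimes>\<^bsub>Free n\<^esub> v = word_mult u v"
  by (simp add: Free_def free_group_def)

lemma Free_one [simp]: "\<one>\<^bsub>Free n\<^esub> = []"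
  by (simp add: Free_def free_group_def)

lemma Free_carrier: "carrier (Free n) = {w. set w \<subseteq> {1..n} \<times> UNIV \<and> reduced w}"
  by (simp add: Free_def free_group_def)

lemma magnus1_mult: "magnus [j] (word_mult u v) = magnus [j] u + magnus [j] v"
  by (simp add: magnus_word_mult magnus1_append)

lemma magnus2_mult:
  "j \<noteq> k \<Longrightarrow> magnus [j, k] (word_mult u v) = magnus [j, k] u + magnus [j] u * magnus [k] v + magnus [j, k] v"
  by (simp add: magnus_word_mult magnus2_append)

lemma magnus3_mult:
  "distinct [j, k, l] \<Longrightarrow> magnus [j, k, l] (word_mult u v) =
     magnus [j, k, l] u + magnus [j, k] u * magnus [l] v + magnus [j] u * magnus [k, l] v + magnus [j, k, l] v"
  by (simp add: magnus_word_mult magnus3_append)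

section \<open>Coefficients of conjugates\<close>

definition conj_word :: "nat \<Rightarrow> nat word \<Rightarrow> nat \<Rightarrow> nat word" where
  "conj_word n w i = w \<otimes>\<^bsub>Free n\<^esub> free_gen i \<otimes>\<^bsub>Free n\<^esub> inv\<^bsub>Free n\<^esub> w"

lemma word_mult_inv: "w \<in> carrier (Free n) \<Longrightarrow> word_mult w (inv\<^bsub>Free n\<^esub> w) = []"
  using group.r_inv[OF group_Free, of w n] by simp

lemma magnus1_conj_word:
  assumes "w \<in> carrier (Free n)"
  shows "magnus [j] (conj_word n w i) = magnus [j] (free_gen i)"
  using arg_cong[OF word_mult_inv[OF assms], of "magnus [j]"]
  by (simp add: conj_word_def magnus1_mult)

text \<open>To second order, \<open>w x_i w^-1\<close> expands to
  \<open>1 + X_i + [w_1, X_i]\<close>, with \<open>w_1\<close> the linear part of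
  \<open>w\<close>.\<close>

lemma magnus2_conj_word:
  assumes "w \<in> carrier (Free n)" "j \<noteq> k"
  shows "magnus [j, k] (conj_word n w i) =
    (if i = k then magnus [j] w else 0) - (if i = j then magnus [k] w else 0)"
  using arg_cong[OF word_mult_inv[OF assms(1)], of "magnus [j, k]"]
    arg_cong[OF word_mult_inv[OF assms(1)], of "magnus [j]"]
    arg_cong[OF word_mult_inv[OF assms(1)], of "magnus [k]"] assms(2)
  by (simp add: conj_word_def magnus1_mult magnus2_mult free_gen_def algebra_simps)

text \<open>Terms that skip the central letter add up to a coefficient of \<open>w w^-1\<close> and
  vanish; in the others \<open>w\<close> supplies \<open>X_j X_k\<close> and its inverse the
  constant term.\<close>

lemma magnus3_conj_word:
  assumes "w \<in> carrier (Free n)" "distinct [j, k, i]"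
  shows "magnus [j, k, i] (conj_word n w i) = magnus [j, k] w"
  using arg_cong[OF word_mult_inv[OF assms(1)], of "magnus [j, k, i]"] assms(2)
  by (simp add: conj_word_def magnus1_mult magnus2_mult magnus3_mult free_gen_def algebra_simps)

lemma additive_Free_eq_0:
  fixes F :: "nat word \<Rightarrow> int"
  assumes "\<And>u v. \<lbrakk>u \<in> carrier (Free n); v \<in> carrier (Free n)\<rbrakk> \<Longrightarrow> F (word_mult u v) = F u + F v"
    and "\<And>i. i \<in> {1..n} \<Longrightarrow> F (free_gen i) = 0" and "w \<in> carrier (Free n)"
  shows "F w = 0"
proof (rule free_group_hom_eqI[OF group_integer_group])
  show "F \<in> hom (free_group {1..n}) integer_group" "(\<lambda>_. 0) \<in> hom (free_group {1..n}) integer_group"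
    using assms(1) unfolding Free_def
    by (auto simp: hom_def Free_mult[unfolded Free_def] simp del: One_nat_def)
qed (use assms in \<open>auto simp: Free_def\<close>)

section \<open>Coordinates on McCool groups\<close>

lemma group_AutoGroup_Free: "group (AutoGroup (Free n))"
  by (intro group.AutoGroup group_Free)

lemma AutoGroup_Free_mult_apply:
  assumes "\<phi> \<in> carrier (AutoGroup (Free n))" "\<psi> \<in> carrier (AutoGroup (Free n))"
    "w \<in> carrier (Free n)"
  shows "(\<phi> \<otimes>\<^bsub>AutoGroup (Free n)\<^esub> \<psi>) w = \<phi> (\<psi> w)"
  using assms by (simp add: AutoGroup_def auto_def BijGroup_def compose_def)

lemma AutoGroup_Free_hom:
  "\<phi> \<in> carrier (AutoGroup (Free n)) \<Longrightarrow> group_hom (Free n) (Free n) \<phi>"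
  by (simp add: group_hom_def group_hom_axioms_def group_Free AutoGroup_def auto_def)

lemma AutoGroup_Free_closed:
  "\<lbrakk>\<phi> \<in> carrier (AutoGroup (Free n)); w \<in> carrier (Free n)\<rbrakk> \<Longrightarrow> \<phi> w \<in> carrier (Free n)"
  using AutoGroup_Free_hom[of \<phi> n] group_hom.hom_closed by fastforce

lemma AutoGroup_Free_apply_word_mult:
  "\<lbrakk>\<phi> \<in> carrier (AutoGroup (Free n)); u \<in> carrier (Free n); v \<in> carrier (Free n)\<rbrakk>
    \<Longrightarrow> \<phi> (word_mult u v) = word_mult (\<phi> u) (\<phi> v)"
  using group_hom.hom_mult[OF AutoGroup_Free_hom, of \<phi> n u v] by simp

lemma AutoGroup_Free_eqI:
  assumes \<phi>: "\<phi> \<in> carrier (AutoGroup (Free n))" and \<psi>: "\<psi> \<in> carrier (AutoGroup (Free n))"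
    and eq: "\<And>i. i \<in> {1..n} \<Longrightarrow> \<phi> (free_gen i) = \<psi> (free_gen i)"
  shows "\<phi> = \<psi>"
proof (rule extensionalityI)
  show "\<phi> \<in> extensional (carrier (Free n))" "\<psi> \<in> extensional (carrier (Free n))"
    using \<phi> \<psi> by (auto simp: AutoGroup_def auto_def Bij_def)
  fix w assume "w \<in> carrier (Free n)"
  then show "\<phi> w = \<psi> w"
    using free_group_hom_eqI[OF group_Free, of \<phi> "{1..n}" n \<psi> w] eq
      AutoGroup_Free_hom[OF \<phi>] AutoGroup_Free_hom[OF \<psi>]
    by (simp add: group_hom_def group_hom_axioms_def del: One_nat_def flip: Free_def)
qed

lemma McCool_group_mult [simp]: "mult (McCool_group n) = mult (AutoGroup (Free n))"
  by (simp add: McCool_group_def)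

lemma upper_McCool_group_mult [simp]: "mult (upper_McCool_group n) = mult (AutoGroup (Free n))"
  by (simp add: upper_McCool_group_def)

lemma mem_McCool_group:
  "\<phi> \<in> carrier (McCool_group n) \<longleftrightarrow> \<phi> \<in> carrier (AutoGroup (Free n)) \<and>
     (\<forall>i\<in>{1..n}. \<exists>w\<in>carrier (Free n). \<phi> (free_gen i) = conj_word n w i)"
  by (simp add: McCool_group_def conj_word_def)

lemma McCool_group_auto: "\<phi> \<in> carrier (McCool_group n) \<Longrightarrow> \<phi> \<in> carrier (AutoGroup (Free n))"
  by (simp add: mem_McCool_group)

lemma McCool_groupE:
  assumes "\<phi> \<in> carrier (McCool_group n)" "i \<in> {1..n}"
  obtains w where "w \<in> carrier (Free n)" "\<phi> (free_gen i) = conj_word n w i"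
  using assms mem_McCool_group by blast

lemma subgroup_McCool_group: "subgroup (carrier (McCool_group n)) (AutoGroup (Free n))"
  using group.group_incl_imp_subgroup[OF group_AutoGroup_Free, of "carrier (McCool_group n)" n]
    group_McCool_group[of n] by (auto simp: McCool_group_def)

lemma upper_subset_McCool_group: "carrier (upper_McCool_group n) \<subseteq> carrier (McCool_group n)"
proof -
  have "{mccool_alpha n i j | i j. 1 \<le> j \<and> j < i \<and> i \<le> n} \<subseteq> carrier (McCool_group n)"
    by (auto intro!: mccool_alpha_in_McCool_group)
  then show ?thesis
    using group.generate_subgroup_incl[OF group_AutoGroup_Free _ subgroup_McCool_group]
    by (simp add: upper_McCool_group_def)
qed

text \<open>
  If \<open>\<phi> x\<^sub>i = w x\<^sub>i w\<inverse>\<close>, then \<open>u_coord i j \<phi>\<close> and \<open>z_coord i j k \<phi>\<close>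
  are the coefficients of \<open>X\<^sub>j\<close> and \<open>X\<^sub>j X\<^sub>k\<close> in the Magnus expansion of \<open>w\<close>.
  Reading them off \<open>\<phi> x\<^sub>i\<close> makes them independent of the choice of \<open>w\<close>.
\<close>

definition u_coord :: "nat \<Rightarrow> nat \<Rightarrow> (nat word \<Rightarrow> nat word) \<Rightarrow> int" where
  "u_coord i j \<phi> = magnus [j, i] (\<phi> (free_gen i))"

definition z_coord :: "nat \<Rightarrow> nat \<Rightarrow> nat \<Rightarrow> (nat word \<Rightarrow> nat word) \<Rightarrow> int" where
  "z_coord i j k \<phi> = magnus [j, k, i] (\<phi> (free_gen i))"

lemma magnus1_free_gen: "magnus [j] (free_gen i) = (if i = j then 1 else 0)"
  by (simp add: free_gen_def)

lemma magnus2_free_gen: "magnus [j, k] (free_gen i) = 0"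
  by (simp add: free_gen_def)

lemma magnus1_McCool_group:
  assumes \<phi>: "\<phi> \<in> carrier (McCool_group n)" and w: "w \<in> carrier (Free n)"
  shows "magnus [j] (\<phi> w) = magnus [j] w"
proof -
  note a = McCool_group_auto[OF \<phi>]
  have "magnus [j] (\<phi> w) - magnus [j] w = 0"
  proof (rule additive_Free_eq_0[OF _ _ w, where F = "\<lambda>w. magnus [j] (\<phi> w) - magnus [j] w"])
    fix i assume "i \<in> {1..n}"
    then obtain v where "v \<in> carrier (Free n)" "\<phi> (free_gen i) = conj_word n v i"
      by (rule McCool_groupE[OF \<phi>])
    then show "magnus [j] (\<phi> (free_gen i)) - magnus [j] (free_gen i) = 0"
      by (simp add: magnus1_conj_word)
  qed (simp add: AutoGroup_Free_apply_word_mult[OF a] magnus1_mult)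
  then show ?thesis by simp
qed

text \<open>McCool automorphisms act trivially on the abelianization, so the cross terms for
  \<open>\<phi> w\<close> and \<open>w\<close> agree and the change of the coefficient is additive
  in \<open>w\<close>. It is therefore determined on generators.\<close>

lemma magnus2_McCool_group:
  assumes \<phi>: "\<phi> \<in> carrier (McCool_group n)" and w: "w \<in> carrier (Free n)" and jk: "j \<noteq> k"
  shows "magnus [j, k] (\<phi> w) =
    magnus [j, k] w + magnus [k] w * u_coord k j \<phi> - magnus [j] w * u_coord j k \<phi>"
proof -
  note a = McCool_group_auto[OF \<phi>]
  have "magnus [j, k] (\<phi> w) -
    (magnus [j, k] w + magnus [k] w * u_coord k j \<phi> - magnus [j] w * u_coord j k \<phi>) = 0"
  proof (rule additive_Free_eq_0[OF _ _ w, where F = "\<lambda>w. magnus [j, k] (\<phi> w) -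
    (magnus [j, k] w + magnus [k] w * u_coord k j \<phi> - magnus [j] w * u_coord j k \<phi>)"])
    fix i assume "i \<in> {1..n}"
    then obtain v where "v \<in> carrier (Free n)" "\<phi> (free_gen i) = conj_word n v i"
      by (rule McCool_groupE[OF \<phi>])
    then show "magnus [j, k] (\<phi> (free_gen i)) - (magnus [j, k] (free_gen i) +
        magnus [k] (free_gen i) * u_coord k j \<phi> - magnus [j] (free_gen i) * u_coord j k \<phi>) = 0"
      using jk by (auto simp: u_coord_def magnus1_free_gen magnus2_free_gen magnus2_conj_word)
  qed (use jk in \<open>simp add: AutoGroup_Free_apply_word_mult[OF a] magnus1_mult magnus2_mult
         magnus1_McCool_group[OF \<phi>] algebra_simps\<close>)
  then show ?thesis by simp
qed

lemma conj_word_McCool_mult: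
  assumes \<phi>: "\<phi> \<in> carrier (McCool_group n)" and \<psi>: "\<psi> \<in> carrier (McCool_group n)"
    and i: "i \<in> {1..n}"
    and v: "v \<in> carrier (Free n)" "\<phi> (free_gen i) = conj_word n v i"
    and w: "w \<in> carrier (Free n)" "\<psi> (free_gen i) = conj_word n w i"
  shows "(\<phi> \<otimes>\<^bsub>AutoGroup (Free n)\<^esub> \<psi>) (free_gen i) = conj_word n (word_mult (\<phi> w) v) i"
proof -
  interpret group "Free n" by (rule group_Free)
  interpret \<phi>: group_hom "Free n" "Free n" \<phi>
    by (rule AutoGroup_Free_hom[OF McCool_group_auto[OF \<phi>]])
  note g = Free_gen_closed[OF i]
  have "\<phi> (\<psi> (free_gen i)) = conj_word n (\<phi> w \<otimes>\<^bsub>Free n\<^esub> v) i"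
    using v w g by (simp add: conj_word_def m_assoc inv_mult_group del: Free_mult)
  then show ?thesis
    using AutoGroup_Free_mult_apply[of \<phi> n \<psi> "free_gen i"] \<phi> \<psi> g
    by (simp add: McCool_group_auto)
qed

lemma u_coord_mult:
  assumes \<phi>: "\<phi> \<in> carrier (McCool_group n)" and \<psi>: "\<psi> \<in> carrier (McCool_group n)"
    and i: "i \<in> {1..n}" and ij: "i \<noteq> j"
  shows "u_coord i j (\<phi> \<otimes>\<^bsub>AutoGroup (Free n)\<^esub> \<psi>) = u_coord i j \<phi> + u_coord i j \<psi>"
proof -
  obtain v where v: "v \<in> carrier (Free n)" "\<phi> (free_gen i) = conj_word n v i"
    using \<phi> i by (rule McCool_groupE)
  obtain w where w: "w \<in> carrier (Free n)" "\<psi> (free_gen i) = conj_word n w i"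
    using \<psi> i by (rule McCool_groupE)
  have "word_mult (\<phi> w) v \<in> carrier (Free n)"
    using group.is_monoid[OF group_Free] monoid.m_closed[of "Free n" "\<phi> w" v]
      AutoGroup_Free_closed[OF McCool_group_auto[OF \<phi>] w(1)] v(1) by simp
  then show ?thesis
    unfolding u_coord_def conj_word_McCool_mult[OF \<phi> \<psi> i v w]
    using ij v w by (simp add: magnus2_conj_word magnus1_mult magnus1_McCool_group[OF \<phi>])
qed

text \<open>The conjugator of the product is \<open>word_mult (\<phi> w) v\<close>. Its
  multiplication gives one cross term, and the change of the second-order coefficient of
  \<open>w\<close> under \<open>\<phi>\<close> gives the other two.\<close>

lemma z_coord_mult:
  assumes \<phi>: "\<phi> \<in> carrier (McCool_group n)" and \<psi>: "\<psi> \<in> carrier (McCool_group n)"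
    and i: "i \<in> {1..n}" and ijk: "distinct [j, k, i]"
  shows "z_coord i j k (\<phi> \<otimes>\<^bsub>AutoGroup (Free n)\<^esub> \<psi>) = z_coord i j k \<phi> + z_coord i j k \<psi> +
    u_coord i j \<psi> * u_coord i k \<phi> + u_coord i k \<psi> * u_coord k j \<phi> - u_coord i j \<psi> * u_coord j k \<phi>"
proof -
  obtain v where v: "v \<in> carrier (Free n)" "\<phi> (free_gen i) = conj_word n v i"
    using \<phi> i by (rule McCool_groupE)
  obtain w where w: "w \<in> carrier (Free n)" "\<psi> (free_gen i) = conj_word n w i"
    using \<psi> i by (rule McCool_groupE)
  have c: "word_mult (\<phi> w) v \<in> carrier (Free n)"
    using group.is_monoid[OF group_Free] monoid.m_closed[of "Free n" "\<phi> w" v]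
      AutoGroup_Free_closed[OF McCool_group_auto[OF \<phi>] w(1)] v(1) by simp
  have u: "u_coord i l \<phi> = magnus [l] v" "u_coord i l \<psi> = magnus [l] w" if "l \<noteq> i" for l
    using v w that by (simp_all add: u_coord_def magnus2_conj_word)
  have jk: "j \<noteq> k" using ijk by simp
  show ?thesis
    unfolding z_coord_def conj_word_McCool_mult[OF \<phi> \<psi> i v w] v(2) w(2)
    using ijk u[of j] u[of k] c v(1) w(1)
    by (simp add: magnus3_conj_word magnus2_mult magnus1_McCool_group[OF \<phi>]
        magnus2_McCool_group[OF \<phi> _ jk] algebra_simps)
qed

text \<open>Additivity is asked on the generated subgroup, since the coordinates are shown to be
  additive on McCool groups and not on all automorphisms.\<close>

lemma additive_generate_eq_0:
  fixes F :: "'a \<Rightarrow> int"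
  assumes G: "group G" and S: "S \<subseteq> carrier G"
    and add: "\<And>x y. \<lbrakk>x \<in> generate G S; y \<in> generate G S\<rbrakk> \<Longrightarrow> F (x \<otimes>\<^bsub>G\<^esub> y) = F x + F y"
    and zero: "\<And>s. s \<in> S \<Longrightarrow> F s = 0" and x: "x \<in> generate G S"
  shows "F x = 0"
proof -
  interpret group G by (rule G)
  have one: "F \<one>\<^bsub>G\<^esub> = 0"
    using add[of "\<one>\<^bsub>G\<^esub>" "\<one>\<^bsub>G\<^esub>"] generate.one[of G S] by simp
  show ?thesis
    using x
  proof (induction x)
    case (inv h)
    then show ?case
      using add[of h "inv\<^bsub>G\<^esub> h"] generate.intros(2,3)[of h S G] S one zero
      by (auto simp: r_inv subset_iff)
  qed (use one zero add in auto)
qed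

lemma u_coord_mccool_alpha:
  assumes "i \<in> {1..n}" "j \<in> {1..n}" "i \<noteq> j" "k \<in> {1..n}" "l \<noteq> k"
  shows "u_coord k l (mccool_alpha n i j) = (if k = i \<and> l = j then 1 else 0)"
proof (cases "k = i")
  case True
  then have "mccool_alpha n i j (free_gen k) = conj_word n (free_gen j) i"
    using assms by (simp add: mccool_alpha_def conj_map_gen Free_gen_closed conj_word_def)
  with True assms show ?thesis
    using Free_gen_closed[of j n]
    by (simp add: u_coord_def magnus2_conj_word magnus1_free_gen)
next
  case False
  then show ?thesis
    using assms by (simp add: u_coord_def mccool_alpha_def conj_map_gen Free_gen_closed magnus2_free_gen)
qed

text \<open>Every generator of the upper group has its first index above its second. This removes
  the term with \<open>u_coord k j\<close> from \<open>z_coord_mult\<close>.\<close>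

lemma u_coord_upper_eq_0:
  assumes \<phi>: "\<phi> \<in> carrier (upper_McCool_group n)" and kj: "k \<in> {1..n}" "k < j"
  shows "u_coord k j \<phi> = 0"
proof (rule additive_generate_eq_0[OF group_AutoGroup_Free, where F = "u_coord k j"])
  show "\<phi> \<in> generate (AutoGroup (Free n)) {mccool_alpha n i j | i j. 1 \<le> j \<and> j < i \<and> i \<le> n}"
    using \<phi> by (simp add: upper_McCool_group_def)
  show "u_coord k j (x \<otimes>\<^bsub>AutoGroup (Free n)\<^esub> y) = u_coord k j x + u_coord k j y"
    if "x \<in> generate (AutoGroup (Free n)) {mccool_alpha n i j | i j. 1 \<le> j \<and> j < i \<and> i \<le> n}"
      "y \<in> generate (AutoGroup (Free n)) {mccool_alpha n i j | i j. 1 \<le> j \<and> j < i \<and> i \<le> n}" for x y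
    using that upper_subset_McCool_group[of n] kj
    by (intro u_coord_mult) (auto simp: upper_McCool_group_def)
qed (use kj in \<open>auto intro!: mccool_alpha_auto simp: u_coord_mccool_alpha\<close>)

text \<open>
  On the upper McCool group the cocycle in \<open>z_coord_mult\<close> becomes bilinear of rank one, so
  \<open>\<phi> \<mapsto> (u_coord i j \<phi>, u_coord i k \<phi> - u_coord j k \<phi>, z_coord i j k \<phi>)\<close>
  is a homomorphism to a Heisenberg group.
\<close>

lemma upper_commute_imp:
  assumes \<phi>: "\<phi> \<in> carrier (upper_McCool_group n)" and \<psi>: "\<psi> \<in> carrier (upper_McCool_group n)"
    and comm: "\<phi> \<otimes>\<^bsub>AutoGroup (Free n)\<^esub> \<psi> = \<psi> \<otimes>\<^bsub>AutoGroup (Free n)\<^esub> \<phi>"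
    and ijk: "1 \<le> k" "k < j" "j < i" "i \<le> n"
  shows "u_coord i j \<phi> * (u_coord i k \<psi> - u_coord j k \<psi>) =
    u_coord i j \<psi> * (u_coord i k \<phi> - u_coord j k \<phi>)"
proof -
  have m: "\<phi> \<in> carrier (McCool_group n)" "\<psi> \<in> carrier (McCool_group n)"
    using \<phi> \<psi> upper_subset_McCool_group by auto
  have i: "i \<in> {1..n}" and d: "distinct [j, k, i]" and k: "k \<in> {1..n}"
    using ijk by auto
  \<comment> \<open>Both products have the same \<open>z_coord i j k\<close>; the symmetric summands
    cancel and leave the cocycle terms.\<close>
  show ?thesis
    using z_coord_mult[OF m i d] z_coord_mult[OF m(2,1) i d] comm
      u_coord_upper_eq_0[OF \<phi> k ijk(2)] u_coord_upper_eq_0[OF \<psi> k ijk(2)]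
    by (simp add: algebra_simps)
qed

section \<open>Generators of the McCool group\<close>

definition inv_word :: "'a word \<Rightarrow> 'a word" where
  "inv_word w = rev (map letter_inv w)"

lemma inv_word_simps [simp]:
  "inv_word [] = []" "inv_word (p # w) = inv_word w @ [letter_inv p]"
  "inv_word (u @ v) = inv_word v @ inv_word u" "length (inv_word w) = length w"
  "inv_word w = [] \<longleftrightarrow> w = []"
  by (auto simp: inv_word_def)

lemma last_inv_word: "w \<noteq> [] \<Longrightarrow> last (inv_word w) = letter_inv (hd w)"
  by (simp add: inv_word_def last_rev list.map_sel)

lemma reduced_append:
  "reduced (u @ v) \<longleftrightarrow> reduced u \<and> reduced v \<and> (u = [] \<or> v = [] \<or> hd v \<noteq> letter_inv (last u))"
  by (auto simp: reduced_def successively_append_iff)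

lemma word_mult_eq_append: "reduced (u @ v) \<Longrightarrow> word_mult u v = u @ v"
  by (induction u) (auto simp: word_mult_Cons reduced_Cons cancel_cons_reduced)

lemma length_cancel_cons_le: "length (cancel_cons p w) \<le> Suc (length w)"
  by (cases w) auto

lemma length_word_mult_le: "length (word_mult u v) \<le> length u + length v"
proof (induction u)
  case (Cons p u)
  then show ?case
    using length_cancel_cons_le[of p "word_mult u v"] by (simp add: word_mult_Cons)
qed simp

lemma word_mult_cancel_middle:
  "reduced v \<Longrightarrow> word_mult (u @ p # letter_inv p # u') v = word_mult (u @ u') v"
  by (simp add: word_mult_append word_mult_Cons cancel_cons_cancel reduced_word_mult)

lemma Free_inv: "w \<in> carrier (Free n) \<Longrightarrow> inv\<^bsub>Free n\<^esub> w = inv_word w"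
  by (rule group.inv_equality[OF group_Free])
     (use word_mult_rev_inv[of "[]" w] in \<open>auto simp: Free_carrier word_mult_Nil2 reduced_rev_inv inv_word_def letter_inv_def\<close>)

text \<open>\<open>word_mult u []\<close> is the free reduction of \<open>u\<close>, so a conjugate
  is one reduction of the word as written.\<close>

lemma conj_word_eq:
  assumes "w \<in> carrier (Free n)" "i \<in> {1..n}"
  shows "conj_word n w i = word_mult (w @ (i, True) # inv_word w) []"
proof -
  have "reduced (inv_word w)"
    using assms by (simp add: Free_carrier inv_word_def reduced_rev_inv)
  moreover have "word_mult (inv_word w) [] = inv_word w"
    using calculation by (rule word_mult_Nil2)
  ultimately show ?thesis
    using word_mult_assoc[of "inv_word w" w "[(i, True)]"] assms
    by (simp add: conj_word_def Free_inv free_gen_def word_mult_append word_mult_Cons)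
qed

text \<open>Trailing letters \<open>(i, s)\<close> of \<open>w\<close> commute with the central
  letter and are stripped one by one; once the last letter belongs to another generator, the written
  conjugate is reduced.\<close>

lemma conj_word_normal_form:
  assumes "w \<in> carrier (Free n)" "i \<in> {1..n}"
  obtains v where "v \<in> carrier (Free n)" "reduced (v @ (i, True) # inv_word v)"
    "conj_word n w i = v @ (i, True) # inv_word v"
proof -
  have "\<exists>v. set v \<subseteq> {1..n} \<times> UNIV \<and> reduced (v @ (i, True) # inv_word v) \<and>
      word_mult (w @ (i, True) # inv_word w) [] = v @ (i, True) # inv_word v"
    if "set w \<subseteq> {1..n} \<times> UNIV" "reduced w" for w :: "nat word"
    using that
  proof (induction w rule: rev_induct)
    case Nil
    then show ?case
      by (intro exI[of _ "[]"]) (auto simp: reduced_Cons word_mult_Cons)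
  next
    case (snoc p w)
    have IH: "\<exists>v. set v \<subseteq> {1..n} \<times> UNIV \<and> reduced (v @ (i, True) # inv_word v) \<and>
      word_mult (w @ (i, True) # inv_word w) [] = v @ (i, True) # inv_word v"
      using snoc by (auto simp: reduced_append)
    show ?case
    proof (cases "fst p = i")
      case True
      then have "p = (i, True) \<or> p = letter_inv (i, True)"
        by (cases p) (auto simp: letter_inv_def)
      then have "word_mult ((w @ [p]) @ (i, True) # inv_word (w @ [p])) [] =
          word_mult (w @ (i, True) # inv_word w) []"
        using word_mult_cancel_middle[of "[]" "w @ [(i, True)]" "(i, True)" "inv_word w"]
          word_mult_cancel_middle[of "[]" w "letter_inv (i, True)" "(i, True) # inv_word w"]
        by auto
      then show ?thesis using IH by simp
    next
      case False
      have "reduced (inv_word (w @ [p]))"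
        using snoc.prems unfolding inv_word_def by (intro reduced_rev_inv)
      then have "reduced ((w @ [p]) @ (i, True) # inv_word (w @ [p]))"
        using snoc.prems False
        by (subst reduced_append) (auto simp: reduced_Cons letter_inv_def)
      then show ?thesis
        using snoc.prems by (intro exI[of _ "w @ [p]"]) (auto intro!: word_mult_Nil2)
    qed
  qed
  from this[of w] assms obtain v where v: "set v \<subseteq> {1..n} \<times> UNIV" "reduced (v @ (i, True) # inv_word v)"
      "word_mult (w @ (i, True) # inv_word w) [] = v @ (i, True) # inv_word v"
    by (auto simp: Free_carrier)
  show ?thesis
    by (rule that[of v]) (use v assms in \<open>auto simp: conj_word_eq Free_carrier reduced_append\<close>)
qed

section \<open>Nielsen cancellation\<close>

lemma common_prefix_decomposition:
  obtains c u' v' where "u = c @ u'" "v = c @ v'" "u' = [] \<or> v' = [] \<or> hd u' \<noteq> hd v'"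
proof -
  have "\<exists>c u' v'. u = c @ u' \<and> v = c @ v' \<and> (u' = [] \<or> v' = [] \<or> hd u' \<noteq> hd v')"
  proof (induction u arbitrary: v)
    case (Cons p u)
    show ?case
    proof (cases "v \<noteq> [] \<and> hd v = p")
      case True
      then obtain v0 where v: "v = p # v0" by (cases v) auto
      obtain c u' v' where "u = c @ u'" "v0 = c @ v'" "u' = [] \<or> v' = [] \<or> hd u' \<noteq> hd v'"
        using Cons by blast
      then show ?thesis
        by (intro exI[of _ "p # c"] exI[of _ u'] exI[of _ v']) (simp add: v)
    qed (rule exI[of _ "[]"], auto)
  qed simp
  with that show ?thesis by blast
qed

text \<open>
  Nielsen's argument: if no \<open>W a x\<^sub>a\<^sup>\<plusminus>\<close> is a prefix of some \<open>W b\<close>, then the central letters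
  \<open>x\<^sub>a\<close> survive the reduction of any reduced product of the conjugates \<open>W a x\<^sub>a\<^sup>\<plusminus> (W a)\<inverse>\<close>.
\<close>

lemma nielsen_reduced_product:
  fixes W :: "'a \<Rightarrow> 'a word"
  defines "y \<equiv> \<lambda>p. W (fst p) @ p # inv_word (W (fst p))"
  assumes red: "\<And>a s. a \<in> X \<Longrightarrow> reduced (y (a, s))"
    and no_absorb: "\<And>p b v. \<lbrakk>fst p \<in> X; b \<in> X\<rbrakk> \<Longrightarrow> W b \<noteq> W (fst p) @ p # v"
    and v: "set (p # v) \<subseteq> X \<times> UNIV" "reduced (p # v)"
  shows "\<exists>t. word_mult (concat (map y (p # v))) [] = W (fst p) @ p # t"
  using v
proof (induction v arbitrary: p)
  case Nil
  then show ?case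
    using red[of "fst p" "snd p"]
    by (intro exI[of _ "inv_word (W (fst p))"]) (auto simp: y_def word_mult_Nil2)
next
  case (Cons q v)
  have X: "fst p \<in> X" "fst q \<in> X" and ne: "q \<noteq> letter_inv p"
    using Cons.prems by (auto simp: reduced_Cons)
  define a b where "a = W (fst p)" and "b = W (fst q)"
  obtain t where t: "word_mult (concat (map y (q # v))) [] = b @ q # t"
    using Cons.IH[of q] Cons.prems by (auto simp: reduced_Cons b_def)
  have R: "reduced (b @ q # t)"
    using reduced_word_mult[of "[]"] unfolding t[symmetric] by simp
  \<comment> \<open>The remaining product starts with \<open>b\<close> and then \<open>q\<close>;
    only the common prefix \<open>c\<close> cancels, between the end of \<open>inv_word a\<close>
    and the start of \<open>b\<close>.\<close>
  obtain c a' b' where c: "a = c @ a'" "b = c @ b'" "a' = [] \<or> b' = [] \<or> hd a' \<noteq> hd b'"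
    by (rule common_prefix_decomposition)
  have y: "reduced (a @ p # inv_word a)"
    using red[of "fst p" "snd p"] X by (simp add: y_def a_def)
  let ?l = "a @ p # inv_word a'" and ?r = "b' @ q # t"
  have r: "reduced ?r" using R by (simp add: c(2) reduced_append)
  have "a @ p # inv_word a = ?l @ inv_word c" using c(1) by simp
  with y have l: "reduced ?l" by (metis reduced_append)
  \<comment> \<open>If one of \<open>a'\<close>, \<open>b'\<close> is empty, a cancellation would
    make one conjugator absorb the other with its central letter; if both are empty,
    \<open>p # q # v\<close> would not be reduced; if neither is, \<open>c\<close> would not be
    maximal.\<close>
  have junction: "hd ?r \<noteq> letter_inv (last ?l)"
  proof (cases "a' = []")
    case a': True
    show ?thesis
    proof (cases b')
      case (Cons q' b'')
      then have "q' \<noteq> letter_inv p"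
        using no_absorb[of "letter_inv p" "fst q" b''] X c a'
        by (auto simp: a_def b_def letter_inv_def)
      then show ?thesis using a' Cons by simp
    qed (use a' ne in simp)
  next
    case a': False
    then have last: "letter_inv (last ?l) = hd a'" by (simp add: last_inv_word)
    show ?thesis
    proof (cases b')
      case Nil
      have "hd a' \<noteq> q"
      proof
        assume "hd a' = q"
        then have "a = b @ q # tl a'" using c Nil a' by auto
        then show False using no_absorb[of q "fst p"] X by (auto simp: a_def b_def)
      qed
      then show ?thesis using Nil last by auto
    qed (use a' c(3) last in auto)
  qed
  have "word_mult (concat (map y (p # q # v))) [] = word_mult (y p) (b @ q # t)"
    using t by (simp add: word_mult_append)
  also have "y p = (a @ [p]) @ inv_word a' @ inv_word c"
    by (simp add: y_def a_def[symmetric] c(1))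
  also have "word_mult \<dots> (b @ q # t) = word_mult ?l ?r"
    using word_mult_rev_inv[OF r, of c] word_mult_eq_append[of c ?r] R c(2)
    by (simp add: word_mult_append word_mult_Cons inv_word_def)
  also have "\<dots> = ?l @ ?r"
    by (rule word_mult_eq_append) (use l r junction reduced_append in blast)
  finally show ?case
    by (intro exI[of _ "inv_word a' @ ?r"]) (simp add: a_def)
qed

lemma AutoGroup_Free_apply_word:
  assumes \<phi>: "\<phi> \<in> carrier (AutoGroup (Free n))"
    and W: "\<And>i. i \<in> {1..n} \<Longrightarrow> \<phi> (free_gen i) = W i @ (i, True) # inv_word (W i)"
    and w: "w \<in> carrier (Free n)"
  shows "\<phi> w = word_mult (concat (map (\<lambda>p. W (fst p) @ p # inv_word (W (fst p))) w)) []"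
proof -
  interpret group "Free n" by (rule group_Free)
  have "\<phi> \<in> hom (free_group {1..n}) (Free n)"
    using AutoGroup_Free_hom[OF \<phi>] by (simp add: group_hom_def group_hom_axioms_def Free_def)
  then have "\<phi> w = free_lift (Free n) (\<phi> \<circ> free_gen) w"
    using w by (intro free_lift_unique) (auto simp: Free_def)
  also have "\<dots> = word_mult (concat (map (\<lambda>p. W (fst p) @ p # inv_word (W (fst p))) w)) []"
  proof -
    have "set w \<subseteq> {1..n} \<times> UNIV" using w by (simp add: Free_carrier)
    then show ?thesis
    proof (induction w)
      case (Cons p w)
      then have i: "fst p \<in> {1..n}" by auto
      have "(if snd p then \<phi> (free_gen (fst p)) else inv\<^bsub>Free n\<^esub> \<phi> (free_gen (fst p))) =
          W (fst p) @ p # inv_word (W (fst p))"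
        using W[OF i] AutoGroup_Free_closed[OF \<phi> Free_gen_closed[OF i]]
        by (cases p) (auto simp: Free_inv letter_inv_def inv_word_def rev_map comp_def)
      then show ?case
        using Cons by (simp add: free_lift_def word_mult_append word_mult_Cons case_prod_unfold)
    qed (simp add: free_lift_def)
  qed
  finally show ?thesis .
qed

section \<open>Nielsen reduction of the total length of the images\<close>

definition conj_length :: "nat \<Rightarrow> (nat word \<Rightarrow> nat word) \<Rightarrow> nat" where
  "conj_length n \<phi> = (\<Sum>i\<in>{1..n}. length (\<phi> (free_gen i)))"

lemma McCool_group_normal_form:
  assumes "\<phi> \<in> carrier (McCool_group n)"
  obtains W where "\<And>i. i \<in> {1..n} \<Longrightarrow> W i \<in> carrier (Free n)"
    "\<And>i. i \<in> {1..n} \<Longrightarrow> reduced (W i @ (i, True) # inv_word (W i))"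
    "\<And>i. i \<in> {1..n} \<Longrightarrow> \<phi> (free_gen i) = W i @ (i, True) # inv_word (W i)"
proof -
  have "\<forall>i\<in>{1..n}. \<exists>v. v \<in> carrier (Free n) \<and> reduced (v @ (i, True) # inv_word v) \<and>
      \<phi> (free_gen i) = v @ (i, True) # inv_word v"
    using assms by (metis McCool_groupE conj_word_normal_form)
  then obtain W where "\<forall>i\<in>{1..n}. W i \<in> carrier (Free n) \<and> reduced (W i @ (i, True) # inv_word (W i)) \<and>
      \<phi> (free_gen i) = W i @ (i, True) # inv_word (W i)"
    by (auto dest!: bchoice)
  with that show ?thesis by blast
qed

text \<open>By surjectivity \<open>x_c\<close> is the image of some word \<open>p # v\<close>, and
  this image begins with \<open>W (fst p)\<close> followed by \<open>p\<close>. As it has length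
  one, \<open>W (fst p)\<close> is empty and \<open>p\<close> is \<open>x_c\<close> itself.\<close>

lemma unabsorbed_conjugators_trivial:
  assumes \<phi>: "\<phi> \<in> carrier (McCool_group n)"
    and red: "\<And>i. i \<in> {1..n} \<Longrightarrow> reduced (W i @ (i, True) # inv_word (W i))"
    and W: "\<And>i. i \<in> {1..n} \<Longrightarrow> \<phi> (free_gen i) = W i @ (i, True) # inv_word (W i)"
    and no_absorb: "\<And>p b v. \<lbrakk>fst p \<in> {1..n}; b \<in> {1..n}\<rbrakk> \<Longrightarrow> W b \<noteq> W (fst p) @ p # v"
    and c: "c \<in> {1..n}"
  shows "W c = []"
proof -
  have "\<phi> ` carrier (Free n) = carrier (Free n)"
    using McCool_group_auto[OF \<phi>] by (simp add: AutoGroup_def auto_def Bij_def bij_betw_def)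
  then obtain w where w: "w \<in> carrier (Free n)" "\<phi> w = free_gen c"
    using Free_gen_closed[OF c] by (metis imageE)
  have red': "reduced (W a @ (a, s) # inv_word (W a))" if "a \<in> {1..n}" for a s
    using red[OF that] reduced_rev_inv[of "W a @ (a, True) # inv_word (W a)"]
    by (cases s) (simp_all add: letter_inv_def inv_word_def rev_map comp_def)
  have eq: "free_gen c = word_mult (concat (map (\<lambda>p. W (fst p) @ p # inv_word (W (fst p))) w)) []"
    using AutoGroup_Free_apply_word[OF McCool_group_auto[OF \<phi>] W w(1)] w(2) by simp
  show ?thesis
  proof (cases w)
    case Nil
    then show ?thesis using eq by (simp add: free_gen_def)
  next
    case (Cons p v)
    have "\<exists>t. word_mult (concat (map (\<lambda>p. W (fst p) @ p # inv_word (W (fst p))) (p # v))) [] =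
        W (fst p) @ p # t"
      by (rule nielsen_reduced_product[of "{1..n}"])
         (use w(1) red' no_absorb in \<open>auto simp: Cons Free_carrier\<close>)
    then obtain t where t: "free_gen c = W (fst p) @ p # t"
      unfolding eq Cons by blast
    then show ?thesis by (cases "W (fst p)") (auto simp: free_gen_def)
  qed
qed

text \<open>Induction on \<open>conj_length\<close>: if \<open>W b\<close> extends
  \<open>W j\<close> by a letter of \<open>x_j\<close>, composing with
  \<open>mccool_alpha n b j\<close> or its inverse deletes that letter; otherwise all conjugators
  are trivial and \<open>\<phi>\<close> is the identity.\<close>

theorem McCool_group_generated:
  "carrier (McCool_group n) =
     generate (AutoGroup (Free n)) {mccool_alpha n i j | i j. i \<in> {1..n} \<and> j \<in> {1..n} \<and> i \<noteq> j}"
    (is "_ = generate ?A ?S")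
proof
  interpret A: group ?A by (rule group_AutoGroup_Free)
  interpret F: group "Free n" by (rule group_Free)
  have SA: "?S \<subseteq> carrier ?A" by (auto intro!: mccool_alpha_auto)
  have "?S \<subseteq> carrier (McCool_group n)"
    by (auto intro!: mccool_alpha_in_McCool_group)
  then show "generate ?A ?S \<subseteq> carrier (McCool_group n)"
    by (rule A.generate_subgroup_incl[OF _ subgroup_McCool_group])
  show "carrier (McCool_group n) \<subseteq> generate ?A ?S"
  proof
    fix \<phi> assume "\<phi> \<in> carrier (McCool_group n)"
    then show "\<phi> \<in> generate ?A ?S"
    proof (induction "conj_length n \<phi>" arbitrary: \<phi> rule: less_induct)
      case less
      note \<phi> = less.prems and a = McCool_group_auto[OF less.prems]
      obtain W where WF: "\<And>i. i \<in> {1..n} \<Longrightarrow> W i \<in> carrier (Free n)"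
        and red: "\<And>i. i \<in> {1..n} \<Longrightarrow> reduced (W i @ (i, True) # inv_word (W i))"
        and W: "\<And>i. i \<in> {1..n} \<Longrightarrow> \<phi> (free_gen i) = W i @ (i, True) # inv_word (W i)"
        using McCool_group_normal_form[OF \<phi>] by blast
      show ?case
      proof (cases "\<exists>p b v. fst p \<in> {1..n} \<and> b \<in> {1..n} \<and> W b = W (fst p) @ p # v")
        case False
        then have no: "W b \<noteq> W (fst p) @ p # v" if "fst p \<in> {1..n}" "b \<in> {1..n}" for p b v
          using that by blast
        have "\<phi> (free_gen c) = free_gen c" if "c \<in> {1..n}" for c
          using unabsorbed_conjugators_trivial[OF \<phi> red W no that] W[OF that]
          by (simp add: free_gen_def)
        then have "\<phi> = \<one>\<^bsub>?A\<^esub>"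
          using AutoGroup_Free_eqI[OF a A.one_closed] Free_gen_closed
          by (simp add: AutoGroup_def BijGroup_def)
        then show ?thesis by (simp add: generate.one)
      next
        case True
        then obtain j s b v where j: "j \<in> {1..n}" and b: "b \<in> {1..n}" and Wb: "W b = W j @ (j, s) # v"
          by fastforce
        have "j \<noteq> b" using Wb by auto
        \<comment> \<open>The sign is opposite to that of the letter \<open>(j, s)\<close> in
          \<open>W b\<close>, so that \<open>\<phi> c\<close> put in front of \<open>W b\<close>
          cancels it.\<close>
        define c where "c = (if s then inv\<^bsub>Free n\<^esub> free_gen j else free_gen j)"
        have gj: "free_gen j \<in> carrier (Free n)" by (rule Free_gen_closed[OF j])
        have c: "c \<in> carrier (Free n)" using gj by (simp add: c_def)
        have c_word: "c = [(j, \<not> s)]"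
          using gj by (simp add: c_def Free_inv) (simp add: free_gen_def letter_inv_def)
        define \<beta> where "\<beta> = (if s then inv\<^bsub>?A\<^esub> mccool_alpha n b j else mccool_alpha n b j)"
        have \<alpha>: "mccool_alpha n b j \<in> ?S" using j b \<open>j \<noteq> b\<close> by blast
        have \<alpha>A: "mccool_alpha n b j \<in> carrier ?A" using \<alpha> SA by blast
        have \<beta>A: "\<beta> \<in> carrier ?A" using \<alpha>A by (simp add: \<beta>_def)
        have \<beta>S: "\<beta> \<in> generate ?A ?S" "inv\<^bsub>?A\<^esub> \<beta> \<in> generate ?A ?S"
          using \<alpha> \<alpha>A by (auto simp: \<beta>_def intro: generate.intros(2,3))
        have \<beta>M: "\<beta> \<in> carrier (McCool_group n)"
          using \<beta>S(1) \<open>generate ?A ?S \<subseteq> carrier (McCool_group n)\<close> by blast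
        have \<beta>_gen: "\<beta> (free_gen k) = (if k = b then conj_word n c b else free_gen k)"
          if k: "k \<in> {1..n}" for k
        proof (cases s)
          case False
          then show ?thesis
            using k gj by (simp add: \<beta>_def mccool_alpha_def conj_map_gen conj_word_def c_def)
        next
          case True
          \<comment> \<open>The values of the inverse group element are found by comparison with an
            explicit left inverse.\<close>
          have eq: "conj_map n b c (mccool_alpha n b j w) = w" if "w \<in> carrier (Free n)" for w
            using conj_map_inverse[OF b j _ _ that, of "free_gen j"] \<open>j \<noteq> b\<close> True
            by (simp add: mccool_alpha_def c_def)
          have "\<beta> w = conj_map n b c w" if w: "w \<in> carrier (Free n)" for w
          proof -
            have "mccool_alpha n b j (\<beta> w) = w"
              using AutoGroup_Free_mult_apply[OF \<alpha>A \<beta>A w] \<alpha>A True w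
              by (simp add: \<beta>_def) (simp add: AutoGroup_def BijGroup_def)
            then show ?thesis
              using eq[OF AutoGroup_Free_closed[OF \<beta>A w]] by simp
          qed
          then show ?thesis
            using k c by (simp add: Free_gen_closed conj_map_gen conj_word_def)
        qed
        let ?\<phi>' = "\<phi> \<otimes>\<^bsub>?A\<^esub> \<beta>"
        have \<phi>': "?\<phi>' \<in> carrier (McCool_group n)"
          using subgroup.m_closed[OF subgroup_McCool_group \<phi> \<beta>M] .
        interpret \<phi>: group_hom "Free n" "Free n" \<phi> by (rule AutoGroup_Free_hom[OF a])
        have other: "?\<phi>' (free_gen k) = \<phi> (free_gen k)" if "k \<in> {1..n}" "k \<noteq> b" for k
          using AutoGroup_Free_mult_apply[OF a \<beta>A Free_gen_closed[OF that(1)]] \<beta>_gen[OF that(1)] that(2)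
          by simp
        define g where "g = word_mult (\<phi> c) (W b)"
        have g: "g = word_mult (W j) v"
        proof -
          have "reduced (W b)" using WF[OF b] by (simp add: Free_carrier)
          then have rv: "reduced ((j, s) # v)" "reduced v"
            unfolding Wb by (auto simp: reduced_append reduced_Cons)
          have "\<phi> c = word_mult (W j @ (j, \<not> s) # inv_word (W j)) []"
            using AutoGroup_Free_apply_word[OF a W c] by (simp add: c_word)
          then have "g = word_mult (W j @ (j, \<not> s) # inv_word (W j)) (W b)"
            using word_mult_assoc[OF \<open>reduced (W b)\<close>, of "W j @ (j, \<not> s) # inv_word (W j)" "[]"]
            by (simp add: g_def)
          also have "W b = word_mult (W j) ((j, s) # v)"
            using \<open>reduced (W b)\<close> by (simp add: Wb word_mult_eq_append)
          also have "word_mult (W j @ (j, \<not> s) # inv_word (W j)) (word_mult (W j) ((j, s) # v)) =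
              word_mult (W j) (cancel_cons (j, \<not> s) ((j, s) # v))"
            using word_mult_rev_inv[OF rv(1), of "W j"]
            by (simp add: word_mult_append word_mult_Cons inv_word_def)
          also have "cancel_cons (j, \<not> s) ((j, s) # v) = v"
            by (simp add: letter_inv_def)
          finally show ?thesis .
        qed
        have gF: "g \<in> carrier (Free n)"
          using F.m_closed[OF \<phi>.hom_closed[OF c] WF[OF b]] by (simp add: g_def)
        have "\<phi> (free_gen b) = conj_word n (W b) b"
          using conj_word_eq[OF WF[OF b] b] word_mult_Nil2[OF red[OF b]] W[OF b] by simp
        then have "?\<phi>' (free_gen b) = conj_word n g b"
          using AutoGroup_Free_mult_apply[OF a \<beta>A Free_gen_closed[OF b]] \<beta>_gen[OF b]
            c WF[OF b] Free_gen_closed[OF b] F.inv_mult_group[of "\<phi> c" "W b"]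
          unfolding g_def conj_word_def Free_mult[symmetric, where n = n]
          by (simp add: F.m_assoc del: Free_mult)
        then have "length (?\<phi>' (free_gen b)) \<le> length (g @ (b, True) # inv_word g)"
          using conj_word_eq[OF gF b] length_word_mult_le[of "g @ (b, True) # inv_word g" "[]"] by simp
        also have "\<dots> < length (\<phi> (free_gen b))"
          using length_word_mult_le[of "W j" v] by (simp add: W[OF b] Wb g)
        finally have lt: "length (?\<phi>' (free_gen b)) < length (\<phi> (free_gen b))" .
        have "length (?\<phi>' (free_gen k)) \<le> length (\<phi> (free_gen k))" if "k \<in> {1..n}" for k
          using lt other[OF that] by (cases "k = b") auto
        with lt b have "conj_length n ?\<phi>' < conj_length n \<phi>"
          unfolding conj_length_def by (intro sum_strict_mono_ex1) blast+
        then have "?\<phi>' \<in> generate ?A ?S"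
          using less.hyps \<phi>' by blast
        then have "?\<phi>' \<otimes>\<^bsub>?A\<^esub> inv\<^bsub>?A\<^esub> \<beta> \<in> generate ?A ?S"
          using \<beta>S(2) by (rule generate.eng)
        then show ?thesis
          using a \<beta>A by (simp add: A.m_assoc)
      qed
    qed
  qed
qed

section \<open>Relators\<close>

lemma mccool_alpha_gen:
  assumes "i \<in> {1..n}" "j \<in> {1..n}" "k \<in> {1..n}"
  shows "mccool_alpha n i j (free_gen k) = (if k = i then conj_word n (free_gen j) i else free_gen k)"
  using assms Free_gen_closed[of j n] by (simp add: mccool_alpha_def conj_map_gen conj_word_def)

lemma AutoGroup_Free_apply_conj_word:
  assumes "\<phi> \<in> carrier (AutoGroup (Free n))" "w \<in> carrier (Free n)" "i \<in> {1..n}"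
  shows "\<phi> (conj_word n w i) =
    \<phi> w \<otimes>\<^bsub>Free n\<^esub> \<phi> (free_gen i) \<otimes>\<^bsub>Free n\<^esub> inv\<^bsub>Free n\<^esub> \<phi> w"
proof -
  interpret \<phi>: group_hom "Free n" "Free n" \<phi> by (rule AutoGroup_Free_hom[OF assms(1)])
  show ?thesis
    using assms Free_gen_closed[OF assms(3)] by (simp add: conj_word_def del: Free_mult)
qed

text \<open>Each factor fixes the generator by which the other conjugates. As \<open>j = l\<close>
  is allowed, two of the three families of relators are covered.\<close>

lemma mccool_alpha_commute_disjoint:
  assumes ij: "i \<in> {1..n}" "j \<in> {1..n}" and kl: "k \<in> {1..n}" "l \<in> {1..n}"
    and d: "i \<noteq> j" "k \<noteq> l" "i \<noteq> k" "i \<noteq> l" "k \<noteq> j"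
  shows "mccool_alpha n i j \<otimes>\<^bsub>AutoGroup (Free n)\<^esub> mccool_alpha n k l =
    mccool_alpha n k l \<otimes>\<^bsub>AutoGroup (Free n)\<^esub> mccool_alpha n i j"
proof (rule AutoGroup_Free_eqI)
  note a = mccool_alpha_auto[OF ij d(1)] mccool_alpha_auto[OF kl d(2)]
  interpret A: group "AutoGroup (Free n)" by (rule group_AutoGroup_Free)
  show "mccool_alpha n i j \<otimes>\<^bsub>AutoGroup (Free n)\<^esub> mccool_alpha n k l \<in> carrier (AutoGroup (Free n))"
    "mccool_alpha n k l \<otimes>\<^bsub>AutoGroup (Free n)\<^esub> mccool_alpha n i j \<in> carrier (AutoGroup (Free n))"
    using a by auto
  fix m assume m: "m \<in> {1..n}"
  show "(mccool_alpha n i j \<otimes>\<^bsub>AutoGroup (Free n)\<^esub> mccool_alpha n k l) (free_gen m) =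
    (mccool_alpha n k l \<otimes>\<^bsub>AutoGroup (Free n)\<^esub> mccool_alpha n i j) (free_gen m)"
    using d ij kl m a
    by (simp add: AutoGroup_Free_mult_apply Free_gen_closed mccool_alpha_gen
        AutoGroup_Free_apply_conj_word conj_word_def[symmetric] del: Free_mult)
qed

text \<open>On the subgroup generated by \<open>x_i\<close>, \<open>x_j\<close>, \<open>x_k\<close>
  the product over \<open>i k\<close> and \<open>j k\<close> is conjugation by \<open>x_k\<close>;
  the third automorphism preserves this subgroup and fixes \<open>x_k\<close>.\<close>

lemma mccool_alpha_commute_triangle:
  assumes i: "i \<in> {1..n}" and j: "j \<in> {1..n}" and k: "k \<in> {1..n}" and d: "distinct [i, j, k]"
  shows "mccool_alpha n i j \<otimes>\<^bsub>AutoGroup (Free n)\<^esub>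
      (mccool_alpha n i k \<otimes>\<^bsub>AutoGroup (Free n)\<^esub> mccool_alpha n j k) =
    mccool_alpha n i k \<otimes>\<^bsub>AutoGroup (Free n)\<^esub> mccool_alpha n j k
      \<otimes>\<^bsub>AutoGroup (Free n)\<^esub> mccool_alpha n i j"
proof (rule AutoGroup_Free_eqI)
  interpret A: group "AutoGroup (Free n)" by (rule group_AutoGroup_Free)
  interpret F: group "Free n" by (rule group_Free)
  have a: "mccool_alpha n i j \<in> carrier (AutoGroup (Free n))"
    "mccool_alpha n i k \<in> carrier (AutoGroup (Free n))"
    "mccool_alpha n j k \<in> carrier (AutoGroup (Free n))"
    using mccool_alpha_auto i j k d by auto
  note g = Free_gen_closed[OF i] Free_gen_closed[OF j] Free_gen_closed[OF k]
  show "mccool_alpha n i j \<otimes>\<^bsub>AutoGroup (Free n)\<^esub>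
      (mccool_alpha n i k \<otimes>\<^bsub>AutoGroup (Free n)\<^esub> mccool_alpha n j k) \<in> carrier (AutoGroup (Free n))"
    "mccool_alpha n i k \<otimes>\<^bsub>AutoGroup (Free n)\<^esub> mccool_alpha n j k
      \<otimes>\<^bsub>AutoGroup (Free n)\<^esub> mccool_alpha n i j \<in> carrier (AutoGroup (Free n))"
    using a by auto
  fix m assume m: "m \<in> {1..n}"
  have cancel: "inv\<^bsub>Free n\<^esub> u \<otimes>\<^bsub>Free n\<^esub> (u \<otimes>\<^bsub>Free n\<^esub> v) = v"
    if "u \<in> carrier (Free n)" "v \<in> carrier (Free n)" for u v
    using that by (simp del: Free_mult Free_one flip: F.m_assoc)
  interpret ij: group_hom "Free n" "Free n" "mccool_alpha n i j" by (rule AutoGroup_Free_hom[OF a(1)])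
  interpret ik: group_hom "Free n" "Free n" "mccool_alpha n i k" by (rule AutoGroup_Free_hom[OF a(2)])
  interpret jk: group_hom "Free n" "Free n" "mccool_alpha n j k" by (rule AutoGroup_Free_hom[OF a(3)])
  show "(mccool_alpha n i j \<otimes>\<^bsub>AutoGroup (Free n)\<^esub>
      (mccool_alpha n i k \<otimes>\<^bsub>AutoGroup (Free n)\<^esub> mccool_alpha n j k)) (free_gen m) =
    (mccool_alpha n i k \<otimes>\<^bsub>AutoGroup (Free n)\<^esub> mccool_alpha n j k
      \<otimes>\<^bsub>AutoGroup (Free n)\<^esub> mccool_alpha n i j) (free_gen m)"
    using d i j k m a g
    by (auto simp: AutoGroup_Free_mult_apply Free_gen_closed mccool_alpha_gen conj_word_def
        F.m_assoc F.inv_mult_group cancel simp del: Free_mult)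
qed

section \<open>Resonance\<close>

text \<open>Gaussian elimination without division, which keeps the solution integral.\<close>

lemma int_homogeneous_system_nontrivial:
  fixes x :: "'i \<Rightarrow> 'c \<Rightarrow> int"
  assumes "finite C" "finite A" "card C < card A"
  shows "\<exists>c. (\<exists>t\<in>A. c t \<noteq> 0) \<and> (\<forall>P\<in>C. (\<Sum>t\<in>A. c t * x t P) = 0)"
  using assms
proof (induction C arbitrary: A x rule: finite_induct)
  case empty
  then obtain t where "t \<in> A" by fastforce
  then show ?case by (intro exI[of _ "\<lambda>_. 1"]) auto
next
  case (insert P C)
  show ?case
  proof (cases "\<forall>t\<in>A. x t P = 0")
    case True
    then show ?thesis
      using insert.IH[of A x] insert by (auto simp: sum.neutral)
  next
    case False
    then obtain m where m: "m \<in> A" "x m P \<noteq> 0" by auto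
    define B where "B = A - {m}"
    have B: "finite B" "card C < card B" "A = insert m B" "m \<notin> B"
      using insert m by (auto simp: B_def)
    \<comment> \<open>Cross-multiplication with the pivot \<open>x m P\<close> clears the entry at
      \<open>P\<close>; \<open>c'\<close> below is the back substitution.\<close>
    obtain c where c: "\<exists>t\<in>B. c t \<noteq> 0"
      and sum0: "\<forall>Q\<in>C. (\<Sum>t\<in>B. c t * (x m P * x t Q - x t P * x m Q)) = 0"
      using insert.IH[OF B(1,2), of "\<lambda>t Q. x m P * x t Q - x t P * x m Q"] by auto
    define c' where "c' t = (if t = m then - (\<Sum>t\<in>B. c t * x t P) else x m P * c t)" for t
    have "(\<Sum>t\<in>A. c' t * x t Q) = (\<Sum>t\<in>B. c t * (x m P * x t Q - x t P * x m Q))" for Q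
    proof -
      have "(\<Sum>t\<in>B. c' t * x t Q) = (\<Sum>t\<in>B. c t * x m P * x t Q)"
        using B(4) by (intro sum.cong) (auto simp: c'_def)
      then show ?thesis
        using B by (simp add: c'_def sum_distrib_left sum_distrib_right right_diff_distrib sum_subtractf mult_ac)
    qed
    moreover have "\<exists>t\<in>A. c' t \<noteq> 0"
      using c B m by (auto simp: c'_def)
    ultimately show ?thesis
      using sum0 by (intro exI[of _ c']) auto
  qed
qed

text \<open>
  A class in the first cohomology of the McCool group is encoded as a function \<open>x\<close> with
  \<open>x i j\<close> its value on \<open>\<alpha>\<^sub>i\<^sub>j\<close>. Vanishing of the cup product of two classes is tested
  on McCool's relators \<open>[\<alpha>\<^sub>i\<^sub>j, \<alpha>\<^sub>k\<^sub>l]\<close>, \<open>[\<alpha>\<^sub>i\<^sub>k, \<alpha>\<^sub>j\<^sub>k]\<close> and \<open>[\<alpha>\<^sub>i\<^sub>j, \<alpha>\<^sub>i\<^sub>k \<alpha>\<^sub>j\<^sub>k]\<close>.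
\<close>

definition cup_zero :: "('a \<Rightarrow> 'a \<Rightarrow> int) \<Rightarrow> ('a \<Rightarrow> 'a \<Rightarrow> int) \<Rightarrow> bool" where
  "cup_zero x y \<longleftrightarrow>
     (\<forall>i j k l. distinct [i, j, k, l] \<longrightarrow> x i j * y k l = x k l * y i j) \<and>
     (\<forall>i j k. distinct [i, j, k] \<longrightarrow> x i k * y j k = x j k * y i k) \<and>
     (\<forall>i j k. distinct [i, j, k] \<longrightarrow> x i j * (y i k + y j k) = y i j * (x i k + x j k))"

text \<open>
  Cohen's components of the resonance variety: the plane \<open>C\<^sub>i\<^sub>j\<close> for \<open>S = {i, j}\<close> and the
  three-dimensional space \<open>C\<^sub>i\<^sub>j\<^sub>k\<close> for \<open>S = {i, j, k}\<close>.
\<close>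

definition resonance_component :: "'a set \<Rightarrow> ('a \<Rightarrow> 'a \<Rightarrow> int) \<Rightarrow> bool" where
  "resonance_component S x \<longleftrightarrow>
     (\<forall>i j. x i j \<noteq> 0 \<longrightarrow> i \<in> S \<and> j \<in> S \<and> i \<noteq> j) \<and>
     (card S = 3 \<longrightarrow> (\<forall>i\<in>S. \<forall>j\<in>S. \<forall>k\<in>S. distinct [i, j, k] \<longrightarrow> x i j + x k j = 0))"

text \<open>Cramer's rule. It kills a pair of entries that is proportional to two independent
  pairs.\<close>

lemma int_plane_eq_0:
  fixes x y a b c d :: int
  assumes "x * b = y * a" "x * d = y * c" "a * d \<noteq> b * c"
  shows "x = 0 \<and> y = 0"
proof -
  have "x * (b * c) = x * (a * d)"
    using assms(1,2) by (metis mult.assoc mult.commute)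
  moreover have "y * (b * c) = y * (a * d)"
    using assms(1,2) by (metis mult.assoc mult.commute)
  ultimately show ?thesis using assms(3) by auto
qed

text \<open>The pairs \<open>(x i j, y i j)\<close> and \<open>(x i k, y i k)\<close> are
  independent. The relations make the column sums inside the triangle and the entries outside it
  proportional to both, hence zero.\<close>

lemma cup_zero_triangle:
  assumes cup: "cup_zero x y" and diag: "\<And>i. x i i = 0" "\<And>i. y i i = 0"
    and ijk: "distinct [i, j, k]" and ne: "x i j * y i k \<noteq> x i k * y i j"
  shows "resonance_component {i, j, k} x" "resonance_component {i, j, k} y"
proof -
  have A: "x i j * y k l = x k l * y i j" if "distinct [i, j, k, l]" for i j k l
    using cup that unfolding cup_zero_def by blast
  have B: "x i k * y j k = x j k * y i k" if "distinct [i, j, k]" for i j k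
    using cup that unfolding cup_zero_def by blast
  have C: "x i j * (y i k + y j k) = y i j * (x i k + x j k)" if "distinct [i, j, k]" for i j k
    using cup that unfolding cup_zero_def by blast
  have Z: "a = 0 \<and> b = 0" if "a * y i j = b * x i j" "a * y i k = b * x i k" for a b
    using int_plane_eq_0[OF that] ne by (simp add: mult.commute)
  have k: "x i k + x j k = 0 \<and> y i k + y j k = 0"
    using C[of i j k] B[of i j k] ijk by (intro Z) (auto simp: algebra_simps)
  have j: "x i j + x k j = 0 \<and> y i j + y k j = 0"
    using C[of i k j] B[of i k j] ijk by (intro Z) (auto simp: algebra_simps)
  have k': "x j k = - x i k" "y j k = - y i k" and j': "x k j = - x i j" "y k j = - y i j"
    using j k by auto
  have i: "x j i + x k i = 0 \<and> y j i + y k i = 0"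
    using C[of j k i] C[of k j i] ijk by (intro Z) (auto simp: j' k' algebra_simps)
  have out: "x a b = 0 \<and> y a b = 0" if ab: "a \<notin> {i, j, k} \<or> b \<notin> {i, j, k} \<or> a = b" for a b
  proof -
    have l: "x i l = 0 \<and> y i l = 0" "x l i = 0 \<and> y l i = 0" "x l j = 0 \<and> y l j = 0"
      "x l k = 0 \<and> y l k = 0" "x j l = 0 \<and> y j l = 0" "x k l = 0 \<and> y k l = 0"
      if l: "l \<notin> {i, j, k}" for l
    proof -
      show "x i l = 0 \<and> y i l = 0"
        using A[of i l j k] A[of i l k j] ijk l by (intro Z) (auto simp: j' k' algebra_simps)
      show "x l i = 0 \<and> y l i = 0"
        using A[of l i j k] A[of l i k j] ijk l by (intro Z) (auto simp: j' k' algebra_simps)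
      show "x l j = 0 \<and> y l j = 0"
        using A[of l j i k] B[of l i j] ijk l by (intro Z) (auto simp: algebra_simps)
      show "x l k = 0 \<and> y l k = 0"
        using A[of l k i j] B[of l i k] ijk l by (intro Z) (auto simp: algebra_simps)
      have s: "x j l + x k l = 0 \<and> y j l + y k l = 0"
        using C[of j k l] C[of k j l] ijk l by (intro Z) (auto simp: j' k' algebra_simps)
      then have s': "x k l = - x j l" "y k l = - y j l" by auto
      show "x j l = 0 \<and> y j l = 0"
        using A[of j l i k] A[of k l i j] ijk l by (intro Z) (auto simp: s' algebra_simps)
      then show "x k l = 0 \<and> y k l = 0" using s' by simp
    qed
    consider "a = b" | "a \<notin> {i, j, k}" "b \<in> {i, j, k}" | "b \<notin> {i, j, k}" "a \<in> {i, j, k}"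
      | "a \<notin> {i, j, k}" "b \<notin> {i, j, k}" "a \<noteq> b"
      using ab by blast
    then show ?thesis
    proof cases
      case 1
      then show ?thesis using diag by simp
    next
      case 2
      then show ?thesis using l(2-4)[of a] by blast
    next
      case 3
      then show ?thesis using l(1,5,6)[of b] by blast
    next
      case 4
      then show ?thesis using A[of a b i j] A[of a b i k] ijk by (intro Z) (simp_all add: mult.commute)
    qed
  qed
  show "resonance_component {i, j, k} x" "resonance_component {i, j, k} y"
    unfolding resonance_component_def using out i j k by (auto simp: add.commute)
qed

text \<open>If some row contains two independent pairs of entries, \<open>cup_zero_triangle\<close>
  applies. Otherwise independence occurs only between opposite positions \<open>(i, j)\<close> and
  \<open>(j, i)\<close>, and every other entry is proportional to both.\<close>

lemma cup_zero_imp_resonance_component: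
  assumes cup: "cup_zero x y" and diag: "\<And>i. x i i = 0" "\<And>i. y i i = 0"
    and indep: "\<And>a b. (\<And>i j. a * x i j + b * y i j = 0) \<Longrightarrow> a = 0 \<and> b = 0"
  obtains S where "card S = 2 \<or> card S = 3" "resonance_component S x" "resonance_component S y"
proof (cases "\<exists>i j k. distinct [i, j, k] \<and> x i j * y i k \<noteq> x i k * y i j")
  case True
  then obtain i j k where ijk: "distinct [i, j, k]" and "x i j * y i k \<noteq> x i k * y i j" by blast
  then have "resonance_component {i, j, k} x" "resonance_component {i, j, k} y"
    using cup_zero_triangle[OF cup diag] by blast+
  with ijk show ?thesis
    by (intro that[of "{i, j, k}"]) auto
next
  case False
  then have I: "x i j * y i k = x i k * y i j" if "distinct [i, j, k]" for i j k
    using that by blast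
  \<comment> \<open>With degenerate rows the third relation becomes proportionality of the entries
    at \<open>i j\<close> and \<open>j k\<close>; the relations then reach all pairs of positions
    except opposite ones.\<close>
  have opp: "c = b \<and> d = a" if ne: "x a b * y c d \<noteq> x c d * y a b" for a b c d
  proof (rule ccontr)
    assume no: "\<not> (c = b \<and> d = a)"
    have A: "x i j * y k l = x k l * y i j" if "distinct [i, j, k, l]" for i j k l
      using cup that unfolding cup_zero_def by blast
    have B: "x i k * y j k = x j k * y i k" if "distinct [i, j, k]" for i j k
      using cup that unfolding cup_zero_def by blast
    have C0: "x i j * (y i k + y j k) = y i j * (x i k + x j k)" if "distinct [i, j, k]" for i j k
      using cup that unfolding cup_zero_def by blast
    have C: "x i j * y j k = x j k * y i j" if "distinct [i, j, k]" for i j k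
      using C0[OF that] I[OF that] by (simp add: algebra_simps)
    have "a \<noteq> b" "c \<noteq> d" using ne diag by auto
    then show False
      using ne no A[of a b c d] B[of a c b] I[of a b d] C[of a b d] C[of c a b]
      by (cases "a = c"; cases "a = d"; cases "b = c"; cases "b = d") auto
  qed
  have "\<exists>i j k l. x i j * y k l \<noteq> x k l * y i j"
  proof (rule ccontr)
    assume no: "\<not> ?thesis"
    have "x i j = 0" for i j
      \<comment> \<open>If all entries are proportional, this combination of \<open>x\<close> and
        \<open>y\<close> vanishes identically.\<close>
      using indep[of "y i j" "- x i j"] no by (simp add: mult.commute)
    then show False using indep[of 1 0] by simp
  qed
  then obtain i j k l where "x i j * y k l \<noteq> x k l * y i j" by blast
  moreover from this have "k = j" "l = i" using opp by blast+
  ultimately have ne: "x i j * y j i \<noteq> x j i * y i j" by simp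
  have ij: "i \<noteq> j" using ne diag by auto
  have out: "x a b = 0 \<and> y a b = 0" if "(a, b) \<noteq> (i, j)" "(a, b) \<noteq> (j, i)" for a b
  proof (rule int_plane_eq_0)
    show "x a b * y i j = y a b * x i j" "x a b * y j i = y a b * x j i"
      using opp[of a b i j] opp[of a b j i] that by (auto simp: mult.commute)
  qed (use ne in \<open>simp add: mult.commute\<close>)
  have "resonance_component {i, j} x" "resonance_component {i, j} y"
    unfolding resonance_component_def using out ij by (force simp: card_insert_if)+
  with ij show ?thesis by (intro that[of "{i, j}"]) auto
qed

section \<open>Dimensions and intersections of the components\<close>

lemma resonance_component_sum:
  assumes "\<And>t. t \<in> A \<Longrightarrow> resonance_component S (x t)"
  shows "resonance_component S (\<lambda>i j. \<Sum>t\<in>A. c t * x t i j)"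
  unfolding resonance_component_def
proof (intro conjI impI allI ballI)
  fix i j assume "(\<Sum>t\<in>A. c t * x t i j) \<noteq> 0"
  then obtain t where "t \<in> A" "x t i j \<noteq> 0"
    by (metis (no_types, lifting) mult_zero_right sum.neutral)
  then show "i \<in> S" "j \<in> S" "i \<noteq> j"
    using assms unfolding resonance_component_def by metis+
next
  fix i j k assume "card S = 3" "i \<in> S" "j \<in> S" "k \<in> S" "distinct [i, j, k]"
  then have "c t * x t i j + c t * x t k j = 0" if "t \<in> A" for t
    using assms[OF that] unfolding resonance_component_def
    by (metis distrib_left mult_zero_right)
  then show "(\<Sum>t\<in>A. c t * x t i j) + (\<Sum>t\<in>A. c t * x t k j) = 0"
    by (simp flip: sum.distrib)
qed

lemma resonance_component_lincomb:
  assumes "resonance_component S x" "resonance_component S y"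
  shows "resonance_component S (\<lambda>i j. a * x i j + b * y i j)"
  using resonance_component_sum[of "{True, False}" S "\<lambda>t. if t then x else y" "\<lambda>t. if t then a else b"] assms
  by simp

lemma resonance_component_outside:
  "resonance_component S x \<Longrightarrow> i \<notin> S \<or> j \<notin> S \<or> i = j \<Longrightarrow> x i j = 0"
  unfolding resonance_component_def by blast

lemma resonance_component_column:
  "\<lbrakk>resonance_component S x; S = {i, j, k}; distinct [i, j, k]\<rbrakk> \<Longrightarrow> x k j = - x i j"
  unfolding resonance_component_def by (simp add: card_insert_if)

text \<open>The two entries of a column are opposite, so one entry from each column determines the
  class: the component has dimension three.\<close>

lemma resonance_component_triangle_eq_0:
  assumes x: "resonance_component {i, j, k} x" and ijk: "distinct [i, j, k]"
    and 0: "x j i = 0" "x k j = 0" "x i k = 0"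
  shows "x a b = 0"
proof (cases "a \<in> {i, j, k} \<and> b \<in> {i, j, k} \<and> a \<noteq> b")
  case True
  have "x k i = - x j i" "x i j = - x k j" "x j k = - x i k"
    using resonance_component_column[OF x, of j i k] resonance_component_column[OF x, of k j i]
      resonance_component_column[OF x, of i k j] ijk by auto
  with True 0 show ?thesis by auto
qed (use resonance_component_outside[OF x] in blast)

lemma resonance_component_dependent:
  assumes S: "card S = 2 \<or> card S = 3" and A: "finite A" "card S < card A"
    and x: "\<And>t. t \<in> A \<Longrightarrow> resonance_component S (x t)"
  shows "\<exists>c. (\<exists>t\<in>A. c t \<noteq> 0) \<and> (\<forall>i j. (\<Sum>t\<in>A. c t * x t i j) = 0)"
proof -
  have sum: "resonance_component S (\<lambda>i j. \<Sum>t\<in>A. c t * x t i j)" for c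
    by (rule resonance_component_sum[OF x])
  show ?thesis
    using S
  proof
    assume "card S = 2"
    then obtain i j where ij: "S = {i, j}" "i \<noteq> j" by (auto simp: card_2_iff)
    obtain c where c: "\<exists>t\<in>A. c t \<noteq> 0" "\<forall>P\<in>{(i, j), (j, i)}. (\<Sum>t\<in>A. c t * case_prod (x t) P) = 0"
      using int_homogeneous_system_nontrivial[of "{(i, j), (j, i)}" A "\<lambda>t. case_prod (x t)"] A ij by auto
    have "(\<Sum>t\<in>A. c t * x t a b) = 0" for a b
      using resonance_component_outside[OF sum] c(2) ij by (cases "(a, b) = (i, j) \<or> (a, b) = (j, i)") auto
    with c show ?thesis by blast
  next
    assume "card S = 3"
    then obtain i j k where ijk: "S = {i, j, k}" "distinct [i, j, k]" by (auto simp: card_3_iff)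
    obtain c where c: "\<exists>t\<in>A. c t \<noteq> 0"
      "\<forall>P\<in>{(j, i), (k, j), (i, k)}. (\<Sum>t\<in>A. c t * case_prod (x t) P) = 0"
      using int_homogeneous_system_nontrivial[of "{(j, i), (k, j), (i, k)}" A "\<lambda>t. case_prod (x t)"] A ijk
      by auto
    have "(\<Sum>t\<in>A. c t * x t a b) = 0" for a b
      by (rule resonance_component_triangle_eq_0[OF _ ijk(2)])
         (use sum[of c] c(2) ijk in auto)
    with c show ?thesis by blast
  qed
qed

lemma resonance_component_dependent_list:
  assumes "card S = 2 \<or> card S = 3" "card S < length xs"
    and "\<And>x. x \<in> set xs \<Longrightarrow> resonance_component S x"
  obtains c t where "t < length xs" "c t \<noteq> (0::int)" "\<And>i j. (\<Sum>t<length xs. c t * (xs ! t) i j) = 0"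
  using resonance_component_dependent[OF assms(1), of "{..<length xs}" "\<lambda>t. xs ! t"] assms(2,3)
  by auto

text \<open>A non-zero entry at \<open>a b\<close> has both indices in \<open>S\<close> and in
  \<open>T\<close>. If \<open>S\<close> is a triple, its column relation makes the entry at
  \<open>c b\<close> non-zero for the third index \<open>c\<close>, so \<open>S\<close> is contained
  in \<open>T\<close>; cardinalities decide the rest.\<close>

lemma resonance_components_inter:
  assumes "resonance_component S x" "resonance_component T x" "S \<noteq> T"
    "card S = 2 \<or> card S = 3" "card T = 2 \<or> card T = 3"
  shows "x a b = 0"
proof (rule ccontr)
  assume ne: "x a b \<noteq> 0"
  have ab: "a \<in> S \<inter> T" "b \<in> S \<inter> T" "a \<noteq> b"
    using resonance_component_outside[OF assms(1), of a b] resonance_component_outside[OF assms(2), of a b] ne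
    by auto
  have *: False if "resonance_component S x" "resonance_component T x" "card S = 3" "c \<in> S" "c \<notin> T"
    "a \<in> S \<inter> T" "b \<in> S \<inter> T" for S T c
  proof -
    have "x a b + x c b = 0"
      using that ab(3) unfolding resonance_component_def by (auto 0 3)
    then show False
      using resonance_component_outside[OF that(2), of c b] that(5) ne by simp
  qed
  have sub: "card S = 3 \<Longrightarrow> S \<subseteq> T" "card T = 3 \<Longrightarrow> T \<subseteq> S"
    using *[of S T] *[of T S] assms(1,2) ab by blast+
  have two: "S = {a, b}" if "card S = 2" "a \<in> S" "b \<in> S" for S
    using that ab(3) by (auto simp: card_2_iff)
  consider "card S = 3" "card T = 3" | "card S = 2" "card T = 2" | "card S = 3" "card T = 2"
    | "card S = 2" "card T = 3"
    using assms(4,5) by blast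
  then show False
  proof cases
    case 3
    have "card S \<le> card T"
      using sub(1) 3 by (intro card_mono) (auto intro: card_ge_0_finite)
    with 3 show False by simp
  next
    case 4
    have "card T \<le> card S"
      using sub(2) 4 by (intro card_mono) (auto intro: card_ge_0_finite)
    with 4 show False by simp
  qed (use assms(3) sub two[of S] two[of T] ab in auto)
qed

text \<open>The classes \<open>e\<close>, \<open>p - q\<close>, \<open>r - s\<close> lie in one
  triple component \<open>S\<close>, whereas \<open>p, r\<close> and \<open>q, s\<close> lie in
  components different from \<open>S\<close>. Each of these misses an index of \<open>S\<close>,
  which leaves too little room in \<open>S\<close> for the two differences to be
  independent.\<close>

lemma no_five_resonant_classes:
  fixes e p q r s :: "'a \<Rightarrow> 'a \<Rightarrow> int"
  assumes diag: "\<And>i. e i i = 0" "\<And>i. p i i = 0" "\<And>i. q i i = 0" "\<And>i. r i i = 0" "\<And>i. s i i = 0"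
    and indep: "\<And>a b c d g. (\<And>i j. a * e i j + b * p i j + c * q i j + d * r i j + g * s i j = 0)
      \<Longrightarrow> a = 0 \<and> b = 0 \<and> c = 0 \<and> d = 0 \<and> g = 0"
    and cup: "cup_zero e (\<lambda>i j. p i j - q i j)" "cup_zero e (\<lambda>i j. r i j - s i j)"
      "cup_zero p r" "cup_zero q s"
  shows False
proof -
  define u v where "u = (\<lambda>i j. p i j - q i j)" and "v = (\<lambda>i j. r i j - s i j)"
  have duv: "u i i = 0" "v i i = 0" for i
    by (simp_all add: u_def v_def diag)
  have indep_euv: "a = 0 \<and> b = 0 \<and> c = 0" if "\<And>i j. a * e i j + b * u i j + c * v i j = 0" for a b c
    using indep[of a b "- b" c "- c"] that by (simp add: u_def v_def algebra_simps)
  have eu: "a = 0 \<and> b = 0" if "\<And>i j. a * e i j + b * u i j = 0" for a b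
    using indep_euv[of a b 0] that by simp
  obtain S where S: "card S = 2 \<or> card S = 3" "resonance_component S e" "resonance_component S u"
    by (rule cup_zero_imp_resonance_component[OF cup(1)[folded u_def] diag(1) duv(1) eu])
  have ev: "a = 0 \<and> b = 0" if "\<And>i j. a * e i j + b * v i j = 0" for a b
    using indep_euv[of a 0 b] that by simp
  obtain S' where S': "card S' = 2 \<or> card S' = 3" "resonance_component S' e" "resonance_component S' v"
    by (rule cup_zero_imp_resonance_component[OF cup(2)[folded v_def] diag(1) duv(2) ev])
  have "S' = S"
  proof (rule ccontr)
    assume "S' \<noteq> S"
    then have "e a b = 0" for a b
      using resonance_components_inter[OF S'(2) S(2)] S S' by blast
    then show False using indep_euv[of 1 0 0] by simp
  qed
  with S' have v: "resonance_component S v" by simp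
  have card3: "card S = 3"
  proof (rule ccontr)
    assume "card S \<noteq> 3"
    then have "card S < length [e, u, v]" using S(1) by simp
    then obtain c t where c: "t < length [e, u, v]" "c t \<noteq> 0"
      "\<And>i j. (\<Sum>t<length [e, u, v]. c t * ([e, u, v] ! t) i j) = 0"
      by (rule resonance_component_dependent_list[OF S(1)]) (use S v in auto)
    have "c 0 = 0 \<and> c (Suc 0) = 0 \<and> c (Suc (Suc 0)) = 0"
      using c(3) by (intro indep_euv) simp
    with c(1,2) show False by (auto simp: less_Suc_eq)
  qed
  have pr: "a = 0 \<and> b = 0" if "\<And>i j. a * p i j + b * r i j = 0" for a b
    using indep[of 0 a 0 b 0] that by simp
  obtain T where T: "card T = 2 \<or> card T = 3" "resonance_component T p" "resonance_component T r"
    by (rule cup_zero_imp_resonance_component[OF cup(3) diag(2,4) pr])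
  have qs: "a = 0 \<and> b = 0" if "\<And>i j. a * q i j + b * s i j = 0" for a b
    using indep[of 0 0 a 0 b] that by simp
  obtain T' where T': "card T' = 2 \<or> card T' = 3" "resonance_component T' q" "resonance_component T' s"
    by (rule cup_zero_imp_resonance_component[OF cup(4) diag(3,5) qs])
  \<comment> \<open>Either of \<open>T = S\<close> and \<open>T' = S\<close> would put four
    independent classes into the three-dimensional component \<open>S\<close>.\<close>
  have four: False if pqr: "resonance_component S p" "resonance_component S q" "resonance_component S r"
  proof -
    have "card S < length [e, p, q, r]" using card3 by simp
    then obtain c t where c: "t < length [e, p, q, r]" "c t \<noteq> 0"
      "\<And>i j. (\<Sum>t<length [e, p, q, r]. c t * ([e, p, q, r] ! t) i j) = 0"
      by (rule resonance_component_dependent_list[OF S(1)]) (use S pqr in auto)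
    have "c 0 = 0 \<and> c (Suc 0) = 0 \<and> c (Suc (Suc 0)) = 0 \<and> c (Suc (Suc (Suc 0))) = 0 \<and> (0::int) = 0"
      using c(3) by (intro indep) simp
    with c(1,2) show False by (auto simp: less_Suc_eq)
  qed
  have "T \<noteq> S"
  proof
    assume "T = S"
    then show False
      using four T resonance_component_lincomb[OF T(2), of u 1 "- 1"] S(3) by (simp add: u_def)
  qed
  have "T' \<noteq> S"
  proof
    assume "T' = S"
    then show False
      using four T' resonance_component_lincomb[OF T'(2), of u 1 1]
        resonance_component_lincomb[OF T'(3), of v 1 1] S(3) v by (simp add: u_def v_def)
  qed
  have missing: "\<exists>k\<in>S. k \<notin> T" if "T \<noteq> S" "card T = 2 \<or> card T = 3" for T
  proof (rule ccontr)
    assume "\<not> ?thesis"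
    moreover have "finite T" "card T \<le> card S"
      using that(2) card3 by (auto intro: card_ge_0_finite)
    ultimately have "S = T"
      by (intro card_seteq) auto
    with that(1) show False by simp
  qed
  obtain k where k: "k \<in> S" "k \<notin> T" using missing T(1) \<open>T \<noteq> S\<close> by blast
  obtain j where j: "j \<in> S" "j \<notin> T'" using missing T'(1) \<open>T' \<noteq> S\<close> by blast
  note zero = resonance_component_outside[OF T(2)] resonance_component_outside[OF T(3)]
    resonance_component_outside[OF T'(2)] resonance_component_outside[OF T'(3)]
  obtain x y z where xyz: "S = {x, y, z}" "distinct [x, y, z]"
    using card3 by (auto simp: card_3_iff)
  show False
  proof (cases "j = k")
    case True
    obtain i l where il: "S = {i, l, k}" "distinct [i, l, k]"
      using xyz k(1) by (auto simp: insert_commute)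
    \<comment> \<open>The index \<open>k\<close> lies in neither \<open>T\<close> nor
      \<open>T'\<close>, so row and column \<open>k\<close> vanish and the column relation removes
      the rest.\<close>
    have uk: "u k a = 0" "u a k = 0" for a
      using zero k j True by (auto simp: u_def)
    moreover have "u l i = 0"
      using resonance_component_column[OF S(3), of k i l] il uk by auto
    ultimately have "u a b = 0" for a b
      using resonance_component_triangle_eq_0[of i l k u] S(3) il by blast
    then show False using indep_euv[of 0 1 0] by simp
  next
    case False
    obtain i where i: "S = {i, j, k}" "distinct [i, j, k]"
      using xyz k(1) j(1) False by (auto simp: insert_commute)
    \<comment> \<open>At \<open>j k\<close> and \<open>k j\<close>, \<open>T\<close> misses
      \<open>k\<close> and \<open>T'\<close> misses \<open>j\<close>. What remains of
      \<open>S\<close> is a line with coordinate \<open>w j i\<close>, too small for both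
      \<open>u\<close> and \<open>v\<close>.\<close>
    have jk: "u j k = 0" "u k j = 0" "v j k = 0" "v k j = 0"
      using zero k j by (auto simp: u_def v_def)
    have det: "w a b = 0" if w: "resonance_component S w" "w j k = 0" "w k j = 0" "w j i = 0" for w a b
    proof -
      have "w i k = 0"
        using resonance_component_column[OF w(1), of j k i] i w by auto
      then show ?thesis
        using resonance_component_triangle_eq_0[of i j k w] i w by blast
    qed
    have "v j i * u a b + - u j i * v a b = 0" for a b
      by (rule det[OF resonance_component_lincomb[OF S(3) v]]) (simp_all add: jk)
    then have "v j i = 0 \<and> - u j i = 0"
      using indep_euv[of 0 "v j i" "- u j i"] by simp
    then have "u a b = 0" for a b
      using det[OF S(3)] jk by simp
    then show False using indep_euv[of 0 1 0] by simp
  qed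
qed

section \<open>Epimorphisms\<close>

theorem proposition1p5:
  fixes n :: nat
  assumes "n \<ge> 4"
  shows "\<not> (\<exists>f. f \<in> epi (McCool_group n) (upper_McCool_group n))"
proof
  assume "\<exists>f. f \<in> epi (McCool_group n) (upper_McCool_group n)"
  then obtain f where hom: "f \<in> hom (McCool_group n) (upper_McCool_group n)"
    and surj: "f ` carrier (McCool_group n) = carrier (upper_McCool_group n)"
    by (auto simp: epi_def)
  let ?A = "AutoGroup (Free n)" and ?G = "carrier (McCool_group n)" and ?K = "carrier (upper_McCool_group n)"
  let ?S = "{mccool_alpha n i j | i j. i \<in> {1..n} \<and> j \<in> {1..n} \<and> i \<noteq> j}"
  have closed: "f \<phi> \<in> ?K" "f \<phi> \<in> ?G" if "\<phi> \<in> ?G" for \<phi>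
    using that surj upper_subset_McCool_group by blast+
  have mult: "f (\<phi> \<otimes>\<^bsub>?A\<^esub> \<psi>) = f \<phi> \<otimes>\<^bsub>?A\<^esub> f \<psi>" if "\<phi> \<in> ?G" "\<psi> \<in> ?G" for \<phi> \<psi>
    using hom_mult[OF hom that] by simp
  have Gmult: "\<phi> \<otimes>\<^bsub>?A\<^esub> \<psi> \<in> ?G" if "\<phi> \<in> ?G" "\<psi> \<in> ?G" for \<phi> \<psi>
    using subgroup.m_closed[OF subgroup_McCool_group that] .
  have \<alpha>: "mccool_alpha n i j \<in> ?G" if "i \<in> {1..n}" "j \<in> {1..n}" "i \<noteq> j" for i j
    using mccool_alpha_in_McCool_group[OF that] .
  \<comment> \<open>Commuting elements have commuting images, to which the Heisenberg condition of
    the upper group applies.\<close>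
  have comm: "u_coord i j (f \<phi>) * (u_coord i k (f \<psi>) - u_coord j k (f \<psi>)) =
      u_coord i j (f \<psi>) * (u_coord i k (f \<phi>) - u_coord j k (f \<phi>))"
    if "1 \<le> k" "k < j" "j < i" "i \<le> n" "\<phi> \<in> ?G" "\<psi> \<in> ?G" "\<phi> \<otimes>\<^bsub>?A\<^esub> \<psi> = \<psi> \<otimes>\<^bsub>?A\<^esub> \<phi>" for i j k \<phi> \<psi>
    by (rule upper_commute_imp) (use that closed in \<open>auto simp flip: mult\<close>)
  \<comment> \<open>The pulled-back class is extended by zero to the diagonal and to indices outside
    \<open>{1..n}\<close>, since \<open>cup_zero\<close> ranges over all naturals.\<close>
  define ev where "ev F i j =
    (if i \<in> {1..n} \<and> j \<in> {1..n} \<and> i \<noteq> j then F (f (mccool_alpha n i j)) else (0::int))"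
    for F :: "(nat word \<Rightarrow> nat word) \<Rightarrow> int" and i j
  have ev: "ev F i j = F (f (mccool_alpha n i j))" if "i \<in> {1..n}" "j \<in> {1..n}" "i \<noteq> j" for F i j
    using that by (simp add: ev_def)
  have ev_0: "ev F i j = 0" if "i \<notin> {1..n} \<or> j \<notin> {1..n} \<or> i = j" for F i j
    using that by (auto simp: ev_def)
  have cup: "cup_zero (ev (u_coord i j)) (ev (\<lambda>\<phi>. u_coord i k \<phi> - u_coord j k \<phi>))"
    if ijk: "1 \<le> k" "k < j" "j < i" "i \<le> n" for i j k
    unfolding cup_zero_def
  proof (intro conjI allI impI)
    let ?x = "u_coord i j" and ?y = "\<lambda>\<phi>. u_coord i k \<phi> - u_coord j k \<phi>"
    fix a b c d :: nat
    assume d: "distinct [a, b, c, d]"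
    show "ev ?x a b * ev ?y c d = ev ?x c d * ev ?y a b"
    proof (cases "{a, b, c, d} \<subseteq> {1..n}")
      case True
      with d have "mccool_alpha n a b \<otimes>\<^bsub>?A\<^esub> mccool_alpha n c d = mccool_alpha n c d \<otimes>\<^bsub>?A\<^esub> mccool_alpha n a b"
        by (intro mccool_alpha_commute_disjoint) auto
      with True d show ?thesis
        using comm[OF ijk \<alpha>[of a b] \<alpha>[of c d]] by (simp add: ev)
    qed (auto simp: ev_def)
  next
    let ?x = "u_coord i j" and ?y = "\<lambda>\<phi>. u_coord i k \<phi> - u_coord j k \<phi>"
    fix a b c :: nat
    assume d: "distinct [a, b, c]"
    show "ev ?x a c * ev ?y b c = ev ?x b c * ev ?y a c"
    proof (cases "{a, b, c} \<subseteq> {1..n}")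
      case True
      with d have "mccool_alpha n a c \<otimes>\<^bsub>?A\<^esub> mccool_alpha n b c = mccool_alpha n b c \<otimes>\<^bsub>?A\<^esub> mccool_alpha n a c"
        by (intro mccool_alpha_commute_disjoint) auto
      with True d show ?thesis
        using comm[OF ijk \<alpha>[of a c] \<alpha>[of b c]] by (simp add: ev)
    qed (auto simp: ev_def)
    show "ev ?x a b * (ev ?y a c + ev ?y b c) = ev ?y a b * (ev ?x a c + ev ?x b c)"
    proof (cases "{a, b, c} \<subseteq> {1..n}")
      case True
      let ?\<beta> = "mccool_alpha n a c \<otimes>\<^bsub>?A\<^esub> mccool_alpha n b c"
      have m: "mccool_alpha n a c \<in> ?G" "mccool_alpha n b c \<in> ?G" "mccool_alpha n a b \<in> ?G" "?\<beta> \<in> ?G"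
        using True d \<alpha> Gmult by auto
      have "mccool_alpha n a b \<otimes>\<^bsub>?A\<^esub> ?\<beta> = ?\<beta> \<otimes>\<^bsub>?A\<^esub> mccool_alpha n a b"
        using True d by (intro mccool_alpha_commute_triangle) auto
      then have "?x (f (mccool_alpha n a b)) * ?y (f ?\<beta>) = ?x (f ?\<beta>) * ?y (f (mccool_alpha n a b))"
        by (rule comm[OF ijk m(3,4)])
      moreover have "u_coord p q (f ?\<beta>) = u_coord p q (f (mccool_alpha n a c)) + u_coord p q (f (mccool_alpha n b c))"
        if "p \<in> {1..n}" "p \<noteq> q" for p q
        using that m closed by (simp add: mult u_coord_mult)
      ultimately show ?thesis
        using True d ijk by (simp add: ev algebra_simps)
    qed (auto simp: ev_def)
  qed
  \<comment> \<open>Subtracting \<open>u_coord 2 1\<close> in both \<open>r\<close> and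
    \<open>s\<close> makes all four products instances of \<open>cup\<close>, with
    \<open>(i, j, k)\<close> equal to (4,3,2), (4,3,1), (4,2,1) and (3,2,1); it cancels in
    \<open>r - s\<close>.\<close>
  define e p q r s where "e = ev (u_coord 4 3)" and "p = ev (u_coord 4 2)" and "q = ev (u_coord 3 2)"
    and "r = ev (\<lambda>\<phi>. u_coord 4 1 \<phi> - u_coord 2 1 \<phi>)" and "s = ev (\<lambda>\<phi>. u_coord 3 1 \<phi> - u_coord 2 1 \<phi>)"
  note defs = e_def p_def q_def r_def s_def
  show False
  proof (rule no_five_resonant_classes[of e p q r s])
    have "(\<lambda>i j. p i j - q i j) = ev (\<lambda>\<phi>. u_coord 4 2 \<phi> - u_coord 3 2 \<phi>)"
      "(\<lambda>i j. r i j - s i j) = ev (\<lambda>\<phi>. u_coord 4 1 \<phi> - u_coord 3 1 \<phi>)"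
      by (auto simp: defs ev_def fun_eq_iff)
    then show "cup_zero e (\<lambda>i j. p i j - q i j)" "cup_zero e (\<lambda>i j. r i j - s i j)"
      using cup[of 2 3 4] cup[of 1 3 4] assms by (simp_all add: e_def)
    show "cup_zero p r" "cup_zero q s"
      using cup[of 1 2 4] cup[of 1 2 3] assms by (simp_all add: defs)
  next
    fix a b c d g :: int
    assume eq0: "a * e i j + b * p i j + c * q i j + d * r i j + g * s i j = 0" for i j
    \<comment> \<open>A relation between the pullbacks makes \<open>\<theta>\<close> vanish on the
      images of the generators, hence on the image of \<open>f\<close>, which by surjectivity is the
      whole upper group.\<close>
    define \<theta> where "\<theta> \<phi> = a * u_coord 4 3 \<phi> + b * u_coord 4 2 \<phi> + c * u_coord 3 2 \<phi> +
      d * (u_coord 4 1 \<phi> - u_coord 2 1 \<phi>) + g * (u_coord 3 1 \<phi> - u_coord 2 1 \<phi>)" for \<phi>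
    have add: "\<theta> (\<phi> \<otimes>\<^bsub>?A\<^esub> \<psi>) = \<theta> \<phi> + \<theta> \<psi>" if "\<phi> \<in> ?G" "\<psi> \<in> ?G" for \<phi> \<psi>
      using assms by (simp add: \<theta>_def u_coord_mult[OF that] algebra_simps)
    have zero: "\<theta> (f \<phi>) = 0" if "\<phi> \<in> ?G" for \<phi>
    proof (rule additive_generate_eq_0[OF group_AutoGroup_Free, where F = "\<lambda>\<phi>. \<theta> (f \<phi>)"])
      show "\<phi> \<in> generate ?A ?S" using that by (simp add: McCool_group_generated)
      show "?S \<subseteq> carrier ?A" by (auto intro!: mccool_alpha_auto)
      show "\<theta> (f (x \<otimes>\<^bsub>?A\<^esub> y)) = \<theta> (f x) + \<theta> (f y)" if "x \<in> generate ?A ?S" "y \<in> generate ?A ?S" for x y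
      proof -
        have "x \<in> ?G" "y \<in> ?G" using that McCool_group_generated[of n] by blast+
        then show ?thesis using closed add by (simp add: mult)
      qed
      show "\<theta> (f x) = 0" if x: "x \<in> ?S" for x
      proof -
        obtain i j where "i \<in> {1..n}" "j \<in> {1..n}" "i \<noteq> j" "x = mccool_alpha n i j"
          using x by blast
        then show ?thesis using eq0[of i j] by (simp add: defs ev \<theta>_def)
      qed
    qed
    have zeroK: "\<theta> \<psi> = 0" if "\<psi> \<in> ?K" for \<psi>
      using that zero unfolding surj[symmetric] by (elim imageE) simp
    have "mccool_alpha n i j \<in> ?K" if "1 \<le> j" "j < i" "i \<le> n" for i j
      using that by (auto simp: upper_McCool_group_def intro!: generate.incl)
    then have "\<theta> (mccool_alpha n i j) = 0" if "1 \<le> j" "j < i" "i \<le> n" for i j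
      using that by (intro zeroK)
    \<comment> \<open>The first five of these generators return \<open>a\<close>, \<open>b\<close>,
      \<open>c\<close>, \<open>d\<close>, \<open>g\<close> in turn.\<close>
    from this[of 3 4] this[of 2 4] this[of 2 3] this[of 1 4] this[of 1 3] this[of 1 2]
    show "a = 0 \<and> b = 0 \<and> c = 0 \<and> d = 0 \<and> g = 0"
      using assms by (simp add: \<theta>_def u_coord_mccool_alpha)
  qed (auto simp: defs ev_0)
qed

end
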